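(* For every $\epsilon > 0$ there exists $c > 0$ such that for every finite convex set $A \subset \mathbb{R}$, \[ |A-A| \geq c\,|A|^{\frac{8}{5} + \frac{1}{3440} - \epsilon}. \]
   Context: A finite set $A = \{a_1 < a_2 < \dots < a_n\} \subset \mathbb{R}$ is called convex if the sequence of consecutive gaps $(a_{j+1}-a_j)_{j=1}^{n-1}$ is strictly increasing. $A-A = \{a_1-a_2 : a_1,a_2\in A\}$. *)

theory Defs
  imports "HOL-Analysis.Analysis"
begin

definition convex_set :: "real set \<Rightarrow> bool" where
  "convex_set A \<longleftrightarrow> finite A \<and>
     (let s = sorted_list_of_set A in
       \<forall>j. j + 2 < length s \<longrightarrow> s ! (j+1) - s ! j < s ! (j+2) - s ! (j+1))"

definition diff_set :: "real set \<Rightarrow> real set" where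
  "diff_set A = {a1 - a2 | a1 a2. a1 \<in> A \<and> a2 \<in> A}"

end

theory Submission
  imports Defs
begin

text \<open>
  Write \<open>r\<^sub>B(x)\<close> for the number of representations \<open>x = a - b\<close>, \<open>a \<in> A\<close>, \<open>b \<in> B\<close>. Convexity enters only through
  the bound \<open>\<Sum>\<^sub>x r\<^sub>B(x)\<^sup>3 \<le> L |A| |B|\<^sup>2\<close> for all finite \<open>B\<close>, with \<open>L\<close> logarithmic in \<open>|A|\<close>.

  Let \<open>n = |A|\<close>, \<open>D = A - A\<close>, \<open>m = |D|\<close>, let \<open>A\<^sub>t = A \<inter> (A + t)\<close>, and let \<open>X\<close> be the set of popular differences.
  Schoen and Shkredov obtain \<open>m \<ge> n powr (8/5)\<close> from \<open>A - A\<^sub>t \<subseteq> D \<inter> (D + t)\<close> and the cubic bound. If this is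
  nearly an equality, then for typical \<open>t\<close> (set \<open>P\<close>) one has \<open>|A\<^sub>t| \<approx> n powr (2/5)\<close>, and the set \<open>Q\<close> of
  popular elements of \<open>A - X\<close> has only about \<open>n powr (9/5)\<close> elements. The energy bound for the pair
  \<open>(A, Q)\<close> then makes the set of pairs \<open>(a - x, b - x)\<close> with \<open>a - b \<in> P\<close> small, so these pairs have many
  collisions: with \<open>p(u)\<close> the number of \<open>a, b \<in> A\<^sub>u\<close> such that \<open>a - b \<in> P\<close>, the sum
  \<open>\<Sum>\<^sub>u p(u) |X \<inter> (X + u)|\<close> is at least about \<open>n powr (39/10)\<close>. On the other hand, every \<open>x \<in> X\<close> has many
  representations, so the cubic bound applied twice gives \<open>\<Sum>\<^sub>u |X \<inter> (X + u)|\<^sup>6 \<lesssim> m\<^sup>1\<^sup>0 / n\<^sup>6\<close>, and Hoelder's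
  inequality bounds the sum by about \<open>n powr (58/15)\<close>. Keeping track of all losses yields
  \<open>n\<^sup>1\<^sup>0\<^sup>2\<^sup>6 \<lesssim> m\<^sup>6\<^sup>4\<^sup>1\<close>, which is stronger than required.
\<close>

section \<open>Inequalities for finite sums\<close>

text \<open>Consecutive values of \<open>k ^ s\<close> differ by at most
  \<open>s * k ^ (s - 1)\<close>, a discrete mean value bound, and these differences telescope to
  \<open>h ^ s\<close>.\<close>

lemma power_le_sum_layers:
  fixes h s :: nat
  assumes "s \<ge> 1"
  shows "real h ^ s \<le> real s * (\<Sum>k=1..h. real k ^ (s - 1))"
proof (induction h)
  case 0
  then show ?case using assms by (simp add: zero_power)
next
  case (Suc h)
  have step: "(x + 1) ^ j \<le> x ^ j + real j * (x + 1) ^ (j - 1)" if "x \<ge> 0" for x :: real and j :: nat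
  proof (induction j)
    case (Suc j)
    have "(x + 1) ^ Suc j = x * (x + 1) ^ j + (x + 1) ^ j"
      by (simp add: algebra_simps)
    also have "x * (x + 1) ^ j \<le> x * (x ^ j + real j * (x + 1) ^ (j - 1))"
      using Suc that by (intro mult_left_mono) auto
    also have "\<dots> \<le> x ^ Suc j + real j * (x + 1) ^ j"
    proof (cases j)
      case (Suc i)
      have "x * (x + 1) ^ i \<le> (x + 1) * (x + 1) ^ i"
        using that by (intro mult_right_mono) auto
      then have "real j * (x * (x + 1) ^ i) \<le> real j * ((x + 1) ^ j)"
        using Suc by (intro mult_left_mono) auto
      then show ?thesis using Suc by (simp add: algebra_simps)
    qed auto
    finally show ?case by (simp add: algebra_simps)
  qed auto
  have "real (Suc h) ^ s \<le> real h ^ s + real s * real (Suc h) ^ (s - 1)"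
    using step[of "real h" s] by (simp add: add.commute)
  with Suc show ?case by (simp add: algebra_simps)
qed

text \<open>Layer-cake summation: level \<open>k\<close> contributes at most
  \<open>s * C / k\<close>. A bound on level sets thus becomes a moment bound at the price of a
  harmonic number, the source of the logarithmic losses.\<close>

lemma sum_power_le_level_sets:
  fixes h :: "'b \<Rightarrow> nat" and C :: real
  assumes fin: "finite I" and s: "s \<ge> 1" and hN: "\<And>x. x \<in> I \<Longrightarrow> h x \<le> N"
    and lev: "\<And>k. k \<ge> 1 \<Longrightarrow> real k ^ s * real (card {x \<in> I. k \<le> h x}) \<le> C"
  shows "(\<Sum>x\<in>I. real (h x) ^ s) \<le> real s * C * harm N"
proof -
  have "(\<Sum>x\<in>I. real (h x) ^ s) \<le> (\<Sum>x\<in>I. real s * (\<Sum>k=1..h x. real k ^ (s - 1)))"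
    by (intro sum_mono power_le_sum_layers s)
  also have "\<dots> = real s * (\<Sum>x\<in>I. \<Sum>k\<in>{1..N}. if k \<le> h x then real k ^ (s - 1) else 0)"
  proof -
    have "(\<Sum>k=1..h x. real k ^ (s - 1)) = (\<Sum>k\<in>{1..N}. if k \<le> h x then real k ^ (s - 1) else 0)"
      if "x \<in> I" for x
    proof -
      have "{1..h x} = {k \<in> {1..N}. k \<le> h x}" using hN[OF that] by auto
      then show ?thesis by (simp only:) (rule sum.inter_filter, simp)
    qed
    then show ?thesis by (simp add: sum_distrib_left)
  qed
  also have "\<dots> = real s * (\<Sum>k\<in>{1..N}. \<Sum>x\<in>I. if k \<le> h x then real k ^ (s - 1) else 0)"
    by (subst sum.swap) simp
  also have "\<dots> = real s * (\<Sum>k\<in>{1..N}. real k ^ (s - 1) * real (card {x \<in> I. k \<le> h x}))"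
    using fin by (simp add: sum.inter_filter[symmetric] mult.commute)
  also have "\<dots> \<le> real s * (\<Sum>k\<in>{1..N}. C * inverse (real k))"
  proof (intro mult_left_mono sum_mono)
    fix k assume k: "k \<in> {1..N}"
    have "real k ^ s = real k * real k ^ (s - 1)"
      using s by (metis Suc_diff_1 power_Suc One_nat_def Suc_le_eq)
    then show "real k ^ (s - 1) * real (card {x \<in> I. k \<le> h x}) \<le> C * inverse (real k)"
      using lev[of k] k by (simp add: field_simps)
  qed simp
  also have "\<dots> = real s * C * harm N"
    by (simp add: harm_def sum_distrib_left mult.assoc)
  finally show ?thesis .
qed

section \<open>Hoelder and Cauchy-Schwarz inequalities\<close>

text \<open>Hoelder with exponents 3/2 and 3: scale both sums of cubes to 1 and sum the pointwise
  inequality \<open>amgm\<close>.\<close>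

lemma Hoelder_sum_square_mult:
  fixes f g :: "'b \<Rightarrow> real"
  assumes f: "\<And>i. i \<in> I \<Longrightarrow> f i \<ge> 0" and g: "\<And>i. i \<in> I \<Longrightarrow> g i \<ge> 0"
  shows "(\<Sum>i\<in>I. f i ^ 2 * g i) ^ 3 \<le> (\<Sum>i\<in>I. f i ^ 3) ^ 2 * (\<Sum>i\<in>I. g i ^ 3)"
proof (cases "finite I")
  case True
  define F where "F = (\<Sum>i\<in>I. f i ^ 3)"
  define G where "G = (\<Sum>i\<in>I. g i ^ 3)"
  have F0: "F \<ge> 0" and G0: "G \<ge> 0"
    unfolding F_def G_def using f g by (auto intro!: sum_nonneg)
  show ?thesis
  proof (cases "F = 0 \<or> G = 0")
    case True
    then have "(\<Sum>i\<in>I. f i ^ 2 * g i) = 0"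
    proof
      assume "F = 0"
      then have "\<forall>i\<in>I. f i ^ 3 = 0"
        unfolding F_def using f \<open>finite I\<close> by (subst (asm) sum_nonneg_eq_0_iff) auto
      then show ?thesis by simp
    next
      assume "G = 0"
      then have "\<forall>i\<in>I. g i ^ 3 = 0"
        unfolding G_def using g \<open>finite I\<close> by (subst (asm) sum_nonneg_eq_0_iff) auto
      then show ?thesis by simp
    qed
    then show ?thesis using F0 G0 by (simp add: F_def G_def)
  next
    case False
    then have Fp: "F > 0" and Gp: "G > 0" using F0 G0 by auto
    define \<phi> where "\<phi> = root 3 F"
    define \<gamma> where "\<gamma> = root 3 G"
    have \<phi>: "\<phi> > 0" "\<phi> ^ 3 = F" and \<gamma>: "\<gamma> > 0" "\<gamma> ^ 3 = G"
      using Fp Gp by (auto simp: \<phi>_def \<gamma>_def)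
    have amgm: "3 * x ^ 2 * y \<le> 2 * x ^ 3 + y ^ 3" if "x \<ge> 0" "y \<ge> 0" for x y :: real
    proof -
      have "2 * x ^ 3 + y ^ 3 - 3 * x ^ 2 * y = (x - y) ^ 2 * (2 * x + y)"
        by (simp add: power2_eq_square power3_eq_cube algebra_simps)
      also have "\<dots> \<ge> 0" using that by simp
      finally show ?thesis by simp
    qed
    have "3 * (\<Sum>i\<in>I. (f i / \<phi>) ^ 2 * (g i / \<gamma>)) \<le> (\<Sum>i\<in>I. 2 * (f i / \<phi>) ^ 3 + (g i / \<gamma>) ^ 3)"
      unfolding sum_distrib_left mult.assoc[symmetric] using f g \<phi> \<gamma> by (intro sum_mono amgm) auto
    also have "\<dots> = 2 * (F / \<phi> ^ 3) + G / \<gamma> ^ 3"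
      by (simp add: sum.distrib F_def G_def power_divide sum_divide_distrib sum_distrib_left)
    also have "\<dots> = 3" using \<phi> \<gamma> Fp Gp by simp
    finally have "(\<Sum>i\<in>I. (f i / \<phi>) ^ 2 * (g i / \<gamma>)) \<le> 1" by simp
    moreover have "(\<Sum>i\<in>I. (f i / \<phi>) ^ 2 * (g i / \<gamma>)) = (\<Sum>i\<in>I. f i ^ 2 * g i) / (\<phi> ^ 2 * \<gamma>)"
      by (simp add: sum_divide_distrib power_divide)
    ultimately have "(\<Sum>i\<in>I. f i ^ 2 * g i) \<le> \<phi> ^ 2 * \<gamma>"
      using \<phi> \<gamma> by (simp add: divide_le_eq)
    then have "(\<Sum>i\<in>I. f i ^ 2 * g i) ^ 3 \<le> (\<phi> ^ 2 * \<gamma>) ^ 3"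
      using f g by (intro power_mono sum_nonneg) auto
    also have "\<dots> = (\<phi> ^ 3) ^ 2 * \<gamma> ^ 3"
      by (simp add: power_mult_distrib flip: power_mult)
    finally show ?thesis using \<phi> \<gamma> by (simp add: F_def G_def)
  qed
qed simp

text \<open>Cauchy-Schwarz for the powers 1/2 and 3/2 of \<open>f\<close>; it interpolates the
  second moment between the first and the third.\<close>

lemma sum_square_square_le:
  fixes f :: "'b \<Rightarrow> real"
  assumes "\<And>i. i \<in> I \<Longrightarrow> f i \<ge> 0"
  shows "(\<Sum>i\<in>I. f i ^ 2) ^ 2 \<le> (\<Sum>i\<in>I. f i) * (\<Sum>i\<in>I. f i ^ 3)"
proof -
  have "(\<Sum>i\<in>I. f i ^ 2) = (\<Sum>i\<in>I. sqrt (f i) * (sqrt (f i) * f i))"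
    by (intro sum.cong) (use assms in \<open>auto simp: power2_eq_square simp flip: mult.assoc\<close>)
  then have "(\<Sum>i\<in>I. f i ^ 2) ^ 2 \<le> (\<Sum>i\<in>I. sqrt (f i) ^ 2) * (\<Sum>i\<in>I. (sqrt (f i) * f i) ^ 2)"
    by (simp only: Cauchy_Schwarz_ineq_sum)
  also have "(\<Sum>i\<in>I. sqrt (f i) ^ 2) = (\<Sum>i\<in>I. f i)"
    by (intro sum.cong) (use assms in auto)
  also have "(\<Sum>i\<in>I. (sqrt (f i) * f i) ^ 2) = (\<Sum>i\<in>I. f i ^ 3)"
    by (intro sum.cong) (use assms in \<open>auto simp: power_mult_distrib power2_eq_square power3_eq_cube\<close>)
  finally show ?thesis .
qed

lemma sum_mult_square_square_le:
  fixes f g :: "'b \<Rightarrow> real"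
  assumes "\<And>i. i \<in> I \<Longrightarrow> f i \<ge> 0"
  shows "(\<Sum>i\<in>I. f i * g i) ^ 2 \<le> (\<Sum>i\<in>I. f i) * (\<Sum>i\<in>I. f i * g i ^ 2)"
proof -
  have "(\<Sum>i\<in>I. f i * g i) = (\<Sum>i\<in>I. sqrt (f i) * (sqrt (f i) * g i))"
    by (intro sum.cong) (use assms in \<open>auto simp flip: mult.assoc\<close>)
  then have "(\<Sum>i\<in>I. f i * g i) ^ 2 \<le> (\<Sum>i\<in>I. sqrt (f i) ^ 2) * (\<Sum>i\<in>I. (sqrt (f i) * g i) ^ 2)"
    by (simp only: Cauchy_Schwarz_ineq_sum)
  also have "(\<Sum>i\<in>I. sqrt (f i) ^ 2) = (\<Sum>i\<in>I. f i)"
    by (intro sum.cong) (use assms in auto)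
  also have "(\<Sum>i\<in>I. (sqrt (f i) * g i) ^ 2) = (\<Sum>i\<in>I. f i * g i ^ 2)"
    by (intro sum.cong) (use assms in \<open>auto simp: power_mult_distrib\<close>)
  finally show ?thesis .
qed

text \<open>Cauchy-Schwarz over the fibres of \<open>f\<close>: their sizes add up to
  \<open>card S\<close>, the squares of their sizes to the number of collisions.\<close>

lemma card_square_le_collisions:
  assumes "finite S"
  shows "real (card S) ^ 2 \<le> real (card (f ` S)) * real (card {(s, t). s \<in> S \<and> t \<in> S \<and> f s = f t})"
proof -
  have cS: "real (card S) = (\<Sum>y\<in>f ` S. real (card {s \<in> S. f s = y}))"
  proof -
    have "card S = (\<Sum>y\<in>f ` S. card {s \<in> S. f s = y})"
      using sum.image_gen[OF assms, of "\<lambda>_. 1 :: nat" f] by simp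
    then show ?thesis by simp
  qed
  have col: "real (card {(s, t). s \<in> S \<and> t \<in> S \<and> f s = f t}) = (\<Sum>y\<in>f ` S. real (card {s \<in> S. f s = y}) ^ 2)"
  proof -
    have "{(s, t). s \<in> S \<and> t \<in> S \<and> f s = f t} = (\<Union>y\<in>f ` S. {s \<in> S. f s = y} \<times> {s \<in> S. f s = y})"
      by auto
    also have "card \<dots> = (\<Sum>y\<in>f ` S. card ({s \<in> S. f s = y} \<times> {s \<in> S. f s = y}))"
      using assms by (intro card_UN_disjoint) auto
    finally show ?thesis by (simp add: card_cartesian_product power2_eq_square)
  qed
  have "(\<Sum>y\<in>f ` S. 1 * real (card {s \<in> S. f s = y})) ^ 2
        \<le> (\<Sum>y\<in>f ` S. 1 ^ 2) * (\<Sum>y\<in>f ` S. real (card {s \<in> S. f s = y}) ^ 2)"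
    by (rule Cauchy_Schwarz_ineq_sum)
  then show ?thesis unfolding cS col by simp
qed

section \<open>Representation counts\<close>

text \<open>Since \<open>a\<close> determines \<open>b = a - x\<close>, counting \<open>a\<close>
  alone counts the representations. In particular \<open>rep A A x\<close> is the size of
  \<open>A\<close> intersected with its translate by \<open>x\<close>.\<close>

definition rep :: "'a::ab_group_add set \<Rightarrow> 'a set \<Rightarrow> 'a \<Rightarrow> nat" where
  "rep A B x = card {a \<in> A. a - x \<in> B}"

definition difs :: "'a::ab_group_add set \<Rightarrow> 'a set \<Rightarrow> 'a set" where
  "difs A B = (\<lambda>(a, b). a - b) ` (A \<times> B)"

text \<open>The additive energy, that is, the number of solutions of
  \<open>a - b = a' - b'\<close>.\<close>

definition energy :: "'a::ab_group_add set \<Rightarrow> 'a set \<Rightarrow> nat" where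
  "energy A B = (\<Sum>x\<in>difs A B. rep A B x ^ 2)"

lemma finite_difs [simp]: "finite A \<Longrightarrow> finite B \<Longrightarrow> finite (difs A B)"
  by (simp add: difs_def)

lemma difsI: "a \<in> A \<Longrightarrow> b \<in> B \<Longrightarrow> a - b \<in> difs A B"
  by (auto simp: difs_def)

lemma rep_le_card: "finite A \<Longrightarrow> rep A B x \<le> card A"
  by (simp add: rep_def card_mono)

lemma sum_rep_eq_card:
  assumes "finite A" "finite B" "finite I"
  shows "(\<Sum>x\<in>I. rep A B x) = card {(a, b). a \<in> A \<and> b \<in> B \<and> a - b \<in> I}"
proof -
  have "(\<Sum>x\<in>I. rep A B x) = card (SIGMA x:I. {a \<in> A. a - x \<in> B})"
    unfolding rep_def using assms by (subst card_SigmaI) auto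
  also have "\<dots> = card {(a, b). a \<in> A \<and> b \<in> B \<and> a - b \<in> I}"
    by (rule bij_betw_same_card[of "\<lambda>(x, a). (a, a - x)"],
        rule bij_betw_byWitness[where f' = "\<lambda>(a, b). (a - b, a)"]) auto
  finally show ?thesis .
qed

lemma sum_rep_le:
  assumes "finite A" "finite B" "finite I"
  shows "(\<Sum>x\<in>I. rep A B x) \<le> card A * card B"
proof -
  have "card {(a, b). a \<in> A \<and> b \<in> B \<and> a - b \<in> I} \<le> card (A \<times> B)"
    using assms by (intro card_mono) auto
  then show ?thesis by (simp add: sum_rep_eq_card assms card_cartesian_product)
qed

lemma sum_rep_difs:
  assumes "finite A" "finite B"
  shows "(\<Sum>x\<in>difs A B. rep A B x) = card A * card B"
proof -
  have "{(a, b). a \<in> A \<and> b \<in> B \<and> a - b \<in> difs A B} = A \<times> B"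
    by (auto intro: difsI)
  then show ?thesis by (simp add: sum_rep_eq_card assms card_cartesian_product)
qed

section \<open>Double counting of additive quadruples\<close>

text \<open>Rewriting \<open>a - a' = b - b'\<close> as \<open>a - b = a' - b'\<close> embeds the
  quadruples counted on the left into those counted by the energy.\<close>

lemma sum_rep_mult_rep_le_energy:
  assumes "finite A" "finite B" "finite I"
  shows "(\<Sum>t\<in>I. rep A A t * rep B B t) \<le> energy A B"
proof -
  have "(\<Sum>t\<in>I. rep A A t * rep B B t)
      = card (SIGMA t:I. {a \<in> A. a - t \<in> A} \<times> {b \<in> B. b - t \<in> B})"
    unfolding rep_def using assms by (subst card_SigmaI) (auto simp: card_cartesian_product)
  also have "\<dots> \<le> card (SIGMA x:difs A B. {a \<in> A. a - x \<in> B} \<times> {a \<in> A. a - x \<in> B})"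
  proof (rule card_inj_on_le)
    show "inj_on (\<lambda>(t, a, b). (a - b, a, a - t)) (SIGMA t:I. {a \<in> A. a - t \<in> A} \<times> {b \<in> B. b - t \<in> B})"
      by (auto simp: inj_on_def)
    show "(\<lambda>(t, a, b). (a - b, a, a - t)) ` (SIGMA t:I. {a \<in> A. a - t \<in> A} \<times> {b \<in> B. b - t \<in> B})
        \<subseteq> (SIGMA x:difs A B. {a \<in> A. a - x \<in> B} \<times> {a \<in> A. a - x \<in> B})"
      by (auto intro: difsI simp: algebra_simps)
    show "finite (SIGMA x:difs A B. {a \<in> A. a - x \<in> B} \<times> {a \<in> A. a - x \<in> B})"
      using assms by auto
  qed
  also have "\<dots> = energy A B"
    unfolding energy_def rep_def using assms
    by (subst card_SigmaI) (auto simp: card_cartesian_product power2_eq_square)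
  finally show ?thesis .
qed

text \<open>The equation \<open>a - a' = x - w\<close> says \<open>a - x = a' - w\<close>; the
  common value is \<open>y\<close>.\<close>

lemma sum_rep_rep_lower:
  assumes "finite A" "finite X" "finite W"
  shows "(\<Sum>w\<in>W. \<Sum>x\<in>X. rep A A (x - w)) \<le> (\<Sum>y\<in>difs A X. rep A X y * rep A W y)"
proof -
  have "(\<Sum>w\<in>W. \<Sum>x\<in>X. rep A A (x - w)) = (\<Sum>(w, x)\<in>W \<times> X. rep A A (x - w))"
    by (simp add: sum.cartesian_product)
  also have "\<dots> = card (SIGMA p:W \<times> X. {a \<in> A. a - (snd p - fst p) \<in> A})"
    unfolding rep_def using assms by (subst card_SigmaI) (auto simp: case_prod_beta)
  also have "\<dots> \<le> card (SIGMA y:difs A X. {a \<in> A. a - y \<in> X} \<times> {a \<in> A. a - y \<in> W})"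
  proof (rule card_inj_on_le)
    let ?f = "\<lambda>(p, a). (a - snd p, a, a - (snd p - fst p))"
    show "inj_on ?f (SIGMA p:W \<times> X. {a \<in> A. a - (snd p - fst p) \<in> A})"
      by (auto simp: inj_on_def)
    show "?f ` (SIGMA p:W \<times> X. {a \<in> A. a - (snd p - fst p) \<in> A})
        \<subseteq> (SIGMA y:difs A X. {a \<in> A. a - y \<in> X} \<times> {a \<in> A. a - y \<in> W})"
      by (auto intro: difsI simp: algebra_simps)
    show "finite (SIGMA y:difs A X. {a \<in> A. a - y \<in> X} \<times> {a \<in> A. a - y \<in> W})"
      using assms by auto
  qed
  also have "\<dots> = (\<Sum>y\<in>difs A X. rep A X y * rep A W y)"
    unfolding rep_def using assms by (subst card_SigmaI) (auto simp: card_cartesian_product)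
  finally show ?thesis .
qed

text \<open>Collisions of \<open>(a, b, c) \<mapsto> (a - c, b - c)\<close> are pairs of triples that differ by a diagonal
  translation \<open>(u, u, u)\<close>.\<close>

lemma card_triples_square_le:
  assumes "finite A" "finite C" and S: "S \<subseteq> A \<times> A \<times> C"
    and V: "\<And>a b c. (a, b, c) \<in> S \<Longrightarrow> a - c \<in> Y \<and> b - c \<in> Y \<and> a - b \<in> V"
    and "finite Y" "finite V"
  shows "real (card S) ^ 2 \<le> real (\<Sum>t\<in>V. rep Y Y t) *
     real (\<Sum>u\<in>difs A A. card {(a, b). a \<in> A \<and> b \<in> A \<and> a - u \<in> A \<and> b - u \<in> A \<and> a - b \<in> V} * rep C C u)"
proof -
  let ?f = "\<lambda>(a, b, c). (a - c, b - c)"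
  let ?p = "\<lambda>u. {(a, b). a \<in> A \<and> b \<in> A \<and> a - u \<in> A \<and> b - u \<in> A \<and> a - b \<in> V}"
  have finS: "finite S" using S assms finite_subset by blast
  have finp: "finite (?p u)" for u
    by (rule finite_subset[of _ "A \<times> A"]) (use assms in auto)
  \<comment> \<open>Translating \<open>a\<close> and \<open>b\<close> by the same \<open>c\<close>
    preserves their difference, so images are pairs in \<open>Y\<close> with difference in
    \<open>V\<close>.\<close>
  have im: "card (?f ` S) \<le> (\<Sum>t\<in>V. rep Y Y t)"
  proof -
    have "?f ` S \<subseteq> {(y, z). y \<in> Y \<and> z \<in> Y \<and> y - z \<in> V}"
    proof clarify
      fix a b c assume "(a, b, c) \<in> S"
      from V[OF this] show "(a - c) \<in> Y \<and> (b - c) \<in> Y \<and> (a - c) - (b - c) \<in> V"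
        by simp
    qed
    moreover have "finite {(y, z). y \<in> Y \<and> z \<in> Y \<and> y - z \<in> V}"
      by (rule finite_subset[of _ "Y \<times> Y"]) (use assms in auto)
    ultimately have "card (?f ` S) \<le> card {(y, z). y \<in> Y \<and> z \<in> Y \<and> y - z \<in> V}"
      by (intro card_mono)
    then show ?thesis by (simp only: sum_rep_eq_card[OF \<open>finite Y\<close> \<open>finite Y\<close> \<open>finite V\<close>])
  qed
  have col: "card {(s, t). s \<in> S \<and> t \<in> S \<and> ?f s = ?f t} \<le> (\<Sum>u\<in>difs A A. card (?p u) * rep C C u)"
  proof -
    let ?Z = "SIGMA u:difs A A. ?p u \<times> {c \<in> C. c - u \<in> C}"
    let ?h = "\<lambda>(u, (a, b), c). ((a, b, c), (a - u, b - u, c - u))"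
    have "{(s, t). s \<in> S \<and> t \<in> S \<and> ?f s = ?f t} \<subseteq> ?h ` ?Z"
    proof clarify
      fix a b c a' b' c'
      assume s: "(a, b, c) \<in> S" and t: "(a', b', c') \<in> S" and e: "a - c = a' - c'" "b - c = b' - c'"
      define u where "u = a - a'"
      have mem: "a \<in> A" "b \<in> A" "c \<in> C" "a' \<in> A" "b' \<in> A" "c' \<in> C" using s t S by auto
      have a': "a' = a - u" by (simp add: u_def)
      have c': "c' = c - u" using e(1) by (simp add: u_def algebra_simps)
      have b': "b' = b - u" using e(2) c' by (simp add: algebra_simps)
      have "(u, (a, b), c) \<in> ?Z"
        using mem V[OF s] difsI[OF mem(1,4)] unfolding a'[symmetric] b'[symmetric] c'[symmetric] u_def[symmetric]
        by (simp add: a'[symmetric] b'[symmetric] c'[symmetric])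
      then show "((a, b, c), (a', b', c')) \<in> ?h ` ?Z"
        by (rule rev_image_eqI) (simp add: a' b' c')
    qed
    moreover have finZ: "finite ?Z" using assms finp by auto
    ultimately have "card {(s, t). s \<in> S \<and> t \<in> S \<and> ?f s = ?f t} \<le> card ?Z"
      by (intro surj_card_le)
    also have "card ?Z = (\<Sum>u\<in>difs A A. card (?p u) * rep C C u)"
      using assms finp by (subst card_SigmaI) (auto simp: card_cartesian_product rep_def)
    finally show ?thesis .
  qed
  have "real (card S) ^ 2 \<le> real (card (?f ` S)) * real (card {(s, t). s \<in> S \<and> t \<in> S \<and> ?f s = ?f t})"
    by (rule card_square_le_collisions[OF finS])
  also have "\<dots> \<le> real (\<Sum>t\<in>V. rep Y Y t) * real (\<Sum>u\<in>difs A A. card (?p u) * rep C C u)"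
    by (intro mult_mono) (use im col in \<open>simp_all only: of_nat_le_iff of_nat_0_le_iff\<close>)
  finally show ?thesis .
qed

lemma card_pairs_le_rep_square:
  assumes "finite A"
  shows "card {(a, b). a \<in> A \<and> b \<in> A \<and> a - u \<in> A \<and> b - u \<in> A \<and> a - b \<in> V} \<le> rep A A u ^ 2"
proof -
  have "card {(a, b). a \<in> A \<and> b \<in> A \<and> a - u \<in> A \<and> b - u \<in> A \<and> a - b \<in> V}
      \<le> card ({a \<in> A. a - u \<in> A} \<times> {a \<in> A. a - u \<in> A})"
    using assms by (intro card_mono) auto
  then show ?thesis by (simp add: rep_def card_cartesian_product power2_eq_square)
qed

text \<open>The parallelogram \<open>a, b, a - u, b - u\<close> has the other side
  \<open>t = a - b\<close>. Grouped by \<open>t\<close>, it is a pair \<open>a\<close>,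
  \<open>a - u\<close> of elements of \<open>A\<close> that stay in \<open>A\<close> after
  subtracting \<open>t\<close>.\<close>

lemma sum_card_pairs_le:
  assumes "finite A" "finite V" "finite I"
  shows "(\<Sum>u\<in>I. card {(a, b). a \<in> A \<and> b \<in> A \<and> a - u \<in> A \<and> b - u \<in> A \<and> a - b \<in> V})
       \<le> (\<Sum>t\<in>V. rep A A t ^ 2)"
proof -
  let ?p = "\<lambda>u. {(a, b). a \<in> A \<and> b \<in> A \<and> a - u \<in> A \<and> b - u \<in> A \<and> a - b \<in> V}"
  let ?Y = "SIGMA t:V. {a \<in> A. a - t \<in> A} \<times> {a \<in> A. a - t \<in> A}"
  have finp: "finite (?p u)" for u
    by (rule finite_subset[of _ "A \<times> A"]) (use assms in auto)
  have "(\<Sum>u\<in>I. card (?p u)) = card (SIGMA u:I. ?p u)"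
    using assms finp by (subst card_SigmaI) auto
  also have "\<dots> \<le> card ?Y"
  proof (rule card_inj_on_le)
    show "inj_on (\<lambda>(u, a, b). (a - b, a, a - u)) (SIGMA u:I. ?p u)"
      by (auto simp: inj_on_def)
    show "(\<lambda>(u, a, b). (a - b, a, a - u)) ` (SIGMA u:I. ?p u) \<subseteq> ?Y"
      by (auto simp: algebra_simps)
    show "finite ?Y" using assms by auto
  qed
  also have "card ?Y = (\<Sum>t\<in>V. rep A A t ^ 2)"
    using assms by (subst card_SigmaI) (auto simp: card_cartesian_product rep_def power2_eq_square)
  finally show ?thesis .
qed

section \<open>Level sets for convex sets\<close>

text \<open>Shifting a window of \<open>d\<close> gaps one place to the right trades its first gap
  for a later, larger one.\<close>

lemma convex_seq_gap_strict_mono: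
  fixes a :: "nat \<Rightarrow> real"
  assumes conv: "\<And>j. j + 2 < n \<Longrightarrow> a (j+1) - a j < a (j+2) - a (j+1)"
    and "i < i'" "0 < d" "i' + d < n"
  shows "a (i + d) - a i < a (i' + d) - a i'"
proof -
  have consec: "a (i+1) - a i < a (j+1) - a j" if "i < j" "j + 1 < n" for i j
    using that
  proof (induction j)
    case (Suc j)
    then show ?case using conv[of j] by (cases "i = j") auto
  qed simp
  show ?thesis using \<open>i < i'\<close> \<open>i' + d < n\<close>
  proof (induction i')
    case (Suc j)
    have "a (j+1) - a j < a (j+d+1) - a (j+d)"
      using Suc.prems \<open>0 < d\<close> by (intro consec) auto
    moreover have "a (i + d) - a i \<le> a (j + d) - a j"
      using Suc by (cases "i = j") auto
    ultimately show ?case by (simp add: algebra_simps)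
  qed simp
qed

text \<open>Markov's inequality: the increments are positive and telescope to at most
  \<open>n\<close>.\<close>

lemma card_large_gaps_le:
  fixes u :: "nat \<Rightarrow> nat" and t :: real
  assumes inc: "\<And>j. j + 1 < K \<Longrightarrow> u j < u (j+1)" and bd: "\<And>j. j < K \<Longrightarrow> u j < n" and "t \<ge> 0"
  shows "t * real (card {j. j + 1 < K \<and> t < real (u (j+1)) - real (u j)}) \<le> real n"
proof (cases "K = 0")
  case False
  let ?B = "{j. j + 1 < K \<and> t < real (u (j+1)) - real (u j)}"
  have sub: "?B \<subseteq> {..<K-1}" by auto
  have "t * real (card ?B) = (\<Sum>j\<in>?B. t)" by simp
  also have "\<dots> \<le> (\<Sum>j\<in>?B. real (u (j+1)) - real (u j))"
    by (intro sum_mono) auto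
  also have "\<dots> \<le> (\<Sum>j<K-1. real (u (j+1)) - real (u j))"
  proof (intro sum_mono2 sub)
    fix j assume "j \<in> {..<K-1} - ?B"
    then have "j + 1 < K" by auto
    from inc[OF this] show "0 \<le> real (u (j+1)) - real (u j)" by simp
  qed simp
  also have "\<dots> = real (u (K-1)) - real (u 0)"
    using sum_lessThan_telescope[of "\<lambda>j. real (u j)" "K-1"] by simp
  also have "\<dots> \<le> real n" using bd[of "K-1"] False by simp
  finally show ?thesis .
qed simp

text \<open>If \<open>x\<close> has \<open>k\<close> representations \<open>a - b\<close>, most pairs of consecutive representations have index gap
  \<open>O(|A|/k)\<close> in \<open>A\<close> and \<open>O(|B|/k)\<close> in \<open>B\<close>. By convexity the two gaps and the smaller element of \<open>B\<close>
  determine \<open>x\<close>.\<close>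

lemma convex_set_level_set_bound:
  assumes cvx: "convex_set A" and finB: "finite B" and finI: "finite I" and k: "k \<ge> 1"
  shows "real k ^ 3 * real (card {x \<in> I. k \<le> rep A B x}) \<le> 256 * real (card A) * real (card B) ^ 2"
proof -
  have finA: "finite A" using cvx by (simp add: convex_set_def)
  define n m where "n = card A" and "m = card B"
  define S where "S = {x \<in> I. k \<le> rep A B x}"
  have finS: "finite S" using finI by (simp add: S_def)
  have weak: "k * card S \<le> n * m"
  proof -
    have "k * card S = (\<Sum>x\<in>S. k)" by simp
    also have "\<dots> \<le> (\<Sum>x\<in>S. rep A B x)" by (intro sum_mono) (simp add: S_def)
    also have "\<dots> \<le> n * m" unfolding n_def m_def by (intro sum_rep_le finA finB finS)
    finally show ?thesis .
  qed
  consider "S = {}" | "k = 1" | "S \<noteq> {}" "k \<ge> 2" using k by linarith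
  then have "real k ^ 3 * real (card S) \<le> 256 * real n * real m ^ 2"
  proof cases
    case 1
    then show ?thesis by simp
  next
    case 2
    have "card S \<le> n * m ^ 2"
      using weak 2 by (cases m) (auto simp: power2_eq_square algebra_simps intro: order_trans)
    then have "real (card S) \<le> real (n * m ^ 2)" by (simp only: of_nat_le_iff)
    moreover have "0 \<le> real n * real m ^ 2" by simp
    ultimately show ?thesis using 2 by simp
  next
    case 3
    define a where "a i = sorted_list_of_set A ! i" for i
    define b where "b i = sorted_list_of_set B ! i" for i
    have a_mono: "a i < a j" if "i < j" "j < n" for i j
      using that finA unfolding a_def n_def
      by (metis sorted_wrt_nth_less strict_sorted_list_of_set length_sorted_list_of_set)
    have b_mono: "b i < b j" if "i < j" "j < m" for i j
      using that finB unfolding b_def m_def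
      by (metis sorted_wrt_nth_less strict_sorted_list_of_set length_sorted_list_of_set)
    have a_ex: "\<exists>i<n. a i = x" if "x \<in> A" for x
      using that finA unfolding a_def n_def
      by (metis in_set_conv_nth set_sorted_list_of_set length_sorted_list_of_set)
    have a_in: "a i \<in> A" if "i < n" for i
      using that finA unfolding a_def n_def
      by (metis nth_mem set_sorted_list_of_set length_sorted_list_of_set)
    have b_ex: "\<exists>i<m. b i = x" if "x \<in> B" for x
      using that finB unfolding b_def m_def
      by (metis in_set_conv_nth set_sorted_list_of_set length_sorted_list_of_set)
    have gap: "a (i + d) - a i < a (i' + d) - a i'" if "i < i'" "0 < d" "i' + d < n" for i i' d
    proof (rule convex_seq_gap_strict_mono[OF _ that])
      fix j assume "j + 2 < n"
      then show "a (j+1) - a j < a (j+2) - a (j+1)"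
        using cvx finA unfolding convex_set_def a_def n_def by (simp add: Let_def)
    qed
    \<comment> \<open>With the factor 8, at most \<open>k / 8\<close> consecutive gaps exceed
      \<open>G\<close> in \<open>A\<close>, and at most \<open>k / 8\<close> exceed \<open>H\<close>
      in \<open>B\<close>.\<close>
    define G where "G = 8 * real n / real k"
    define H where "H = 8 * real m / real k"
    have G0: "G \<ge> 0" and H0: "H \<ge> 0" by (auto simp: G_def H_def)
    define Z where "Z = {(i, d, p, e). i + d < n \<and> p + e < m \<and> 1 \<le> d \<and> 1 \<le> e \<and>
        real d \<le> G \<and> real e \<le> H \<and> a (i + d) - a i = b (p + e) - b p}"
    have finZ: "finite Z"
      by (rule finite_subset[of _ "{..n} \<times> {..n} \<times> {..m} \<times> {..m}"]) (auto simp: Z_def)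
    \<comment> \<open>The data \<open>d, p, e\<close> fix the value \<open>b (p + e) - b p\<close>,
      and \<open>gap\<close> then allows only one \<open>i\<close>.\<close>
    have cardZ: "real (card Z) \<le> G * real m * H"
    proof -
      have "card Z \<le> card ({1..nat \<lfloor>G\<rfloor>} \<times> {..<m} \<times> {1..nat \<lfloor>H\<rfloor>})"
      proof (rule card_inj_on_le)
        show "inj_on (\<lambda>(i, d, p, e). (d, p, e)) Z"
        proof -
          have "i = i'" if "(i, d, p, e) \<in> Z" "(i', d, p, e) \<in> Z" for i d p e i'
          proof -
            have "a (i + d) - a i = a (i' + d) - a i'" "i + d < n" "i' + d < n" "0 < d"
              using that by (auto simp: Z_def)
            then show "i = i'" using gap[of i i' d] gap[of i' i d] by (metis less_irrefl linorder_neqE_nat)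
          qed
          then show ?thesis by (auto simp: inj_on_def)
        qed
        show "(\<lambda>(i, d, p, e). (d, p, e)) ` Z \<subseteq> {1..nat \<lfloor>G\<rfloor>} \<times> {..<m} \<times> {1..nat \<lfloor>H\<rfloor>}"
          by (auto simp: Z_def le_nat_floor)
      qed simp
      also have "\<dots> = nat \<lfloor>G\<rfloor> * (m * nat \<lfloor>H\<rfloor>)" by (simp add: card_cartesian_product)
      finally have "real (card Z) \<le> real (nat \<lfloor>G\<rfloor>) * (real m * real (nat \<lfloor>H\<rfloor>))"
        by (metis of_nat_le_iff of_nat_mult)
      also have "\<dots> \<le> G * (real m * H)"
        using G0 H0 by (intro mult_mono) auto
      finally show ?thesis by (simp add: mult.assoc)
    qed
    have each: "real k / 4 \<le> real (card {(i, d, p, e). (i, d, p, e) \<in> Z \<and> a i - b p = x})" if "x \<in> S" for x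
    proof -
      define J where "J = {i. i < n \<and> a i - x \<in> B}"
      have finJ: "finite J" by (simp add: J_def)
      have "a ` J = {y \<in> A. y - x \<in> B}"
        using a_ex a_in by (auto simp: J_def image_iff)
      then have "rep A B x \<le> card J"
        unfolding rep_def by (metis card_image_le finJ)
      then have kJ: "k \<le> card J" using that by (simp add: S_def)
      define K where "K = card J"
      define u where "u j = sorted_list_of_set J ! j" for j
      have u_in: "u j \<in> J" if "j < K" for j
        using that finJ unfolding u_def K_def
        by (metis nth_mem set_sorted_list_of_set length_sorted_list_of_set)
      have u_inc: "u i < u j" if "i < j" "j < K" for i j
        using that finJ unfolding u_def K_def
        by (metis sorted_wrt_nth_less strict_sorted_list_of_set length_sorted_list_of_set)
      have "\<exists>p<m. b p = a (u j) - x" if "j < K" for j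
        using u_in[OF that] b_ex by (auto simp: J_def)
      then obtain v where v: "\<And>j. j < K \<Longrightarrow> v j < m \<and> b (v j) = a (u j) - x"
        by metis
      \<comment> \<open>All differences \<open>a (u j) - b (v j)\<close> equal \<open>x\<close>, so
        both index sequences increase together.\<close>
      have v_inc: "v j < v (j+1)" if "j + 1 < K" for j
      proof (rule ccontr)
        assume "\<not> v j < v (j+1)"
        then have "b (v (j+1)) \<le> b (v j)"
          using b_mono[of "v (j+1)" "v j"] v[of j] that by (cases "v (j+1) = v j") auto
        moreover have "a (u j) < a (u (j+1))"
          using a_mono u_inc[of j "j+1"] u_in[of "j+1"] that by (auto simp: J_def)
        ultimately show False using v[of j] v[of "j+1"] that by auto
      qed
      let ?b1 = "{j. j + 1 < K \<and> G < real (u (j+1)) - real (u j)}"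
      let ?b2 = "{j. j + 1 < K \<and> H < real (v (j+1)) - real (v j)}"
      define Gd where "Gd = {..<K-1} - ?b1 - ?b2"
      have "G * real (card ?b1) \<le> real n"
        using u_inc u_in G0 by (intro card_large_gaps_le) (auto simp: J_def)
      moreover have "n > 0" using u_in[of 0] kJ k K_def by (auto simp: J_def)
      ultimately have b1: "real (card ?b1) \<le> real k / 8"
        using 3 by (simp add: G_def field_simps)
      have "H * real (card ?b2) \<le> real m"
        using v_inc v H0 by (intro card_large_gaps_le) auto
      moreover have "m > 0" using v[of 0] kJ k K_def by auto
      ultimately have b2: "real (card ?b2) \<le> real k / 8"
        using 3 by (simp add: H_def field_simps)
      have "card {..<K-1} \<le> card (Gd \<union> (?b1 \<union> ?b2))"
      proof (rule card_mono)
        have "finite ?b1" "finite ?b2" by (auto intro: finite_subset[of _ "{..<K}"])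
        then show "finite (Gd \<union> (?b1 \<union> ?b2))" by (simp add: Gd_def)
      qed (auto simp: Gd_def)
      also have "\<dots> \<le> card Gd + (card ?b1 + card ?b2)"
        by (meson card_Un_le add_left_mono order_trans)
      finally have "real (K - 1) \<le> real (card Gd) + (real (card ?b1) + real (card ?b2))"
        by (simp flip: of_nat_add)
      moreover have "real (K - 1) \<ge> real k - 1" using kJ K_def k by simp
      ultimately have "real k - 1 - real k / 4 \<le> real (card Gd)" using b1 b2 by linarith
      \<comment> \<open>This uses \<open>3 * k / 4 - 1 \<ge> k / 4\<close>, valid from
        \<open>k = 2\<close> on; hence the separate case \<open>k = 1\<close>.\<close>
      then have Gd: "real k / 4 \<le> real (card Gd)" using 3 by simp
      have "card Gd \<le> card {(i, d, p, e). (i, d, p, e) \<in> Z \<and> a i - b p = x}"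
      proof (rule card_inj_on_le)
        let ?f = "\<lambda>j. (u j, u (j+1) - u j, v j, v (j+1) - v j)"
        show "inj_on ?f Gd"
        proof (rule inj_onI)
          fix i j assume "i \<in> Gd" "j \<in> Gd" "?f i = ?f j"
          then have "i < K" "j < K" "u i = u j" by (auto simp: Gd_def)
          then show "i = j" using u_inc[of i j] u_inc[of j i] by (metis less_irrefl linorder_neqE_nat)
        qed
        show "?f ` Gd \<subseteq> {(i, d, p, e). (i, d, p, e) \<in> Z \<and> a i - b p = x}"
        proof clarify
          fix j assume "j \<in> Gd"
          then have j: "j + 1 < K" "j < K" "\<not> G < real (u (j+1)) - real (u j)" "\<not> H < real (v (j+1)) - real (v j)"
            by (auto simp: Gd_def)
          have ui: "u j < u (j+1)" and vi: "v j < v (j+1)" using u_inc[of j "j+1"] v_inc j by auto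
          have un: "u (j+1) < n" using u_in j by (auto simp: J_def)
          show "(u j, u (j+1) - u j, v j, v (j+1) - v j) \<in> Z \<and> a (u j) - b (v j) = x"
            using ui vi un j v[of j] v[of "j+1"] by (auto simp: Z_def of_nat_diff)
        qed
        show "finite {(i, d, p, e). (i, d, p, e) \<in> Z \<and> a i - b p = x}"
          by (rule finite_subset[OF _ finZ]) auto
      qed
      then show ?thesis using Gd by linarith
    qed
    \<comment> \<open>The parts of \<open>Z\<close> belonging to different \<open>x\<close> are
      disjoint, so their sizes add up to at most \<open>card Z\<close>.\<close>
    have "real (card S) * (real k / 4) = (\<Sum>x\<in>S. real k / 4)" by simp
    also have "\<dots> \<le> (\<Sum>x\<in>S. real (card {(i, d, p, e). (i, d, p, e) \<in> Z \<and> a i - b p = x}))"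
      by (intro sum_mono each)
    also have "\<dots> = real (card (\<Union>x\<in>S. {(i, d, p, e). (i, d, p, e) \<in> Z \<and> a i - b p = x}))"
      unfolding of_nat_sum[symmetric]
      by (subst card_UN_disjoint) (use finS finZ in \<open>auto intro: finite_subset[OF _ finZ]\<close>)
    also have "\<dots> \<le> real (card Z)"
      using finZ by (intro of_nat_mono card_mono) auto
    also have "\<dots> \<le> G * real m * H" by (rule cardZ)
    also have "\<dots> = 64 * real n * real m ^ 2 / real k ^ 2"
      by (simp add: G_def H_def power2_eq_square)
    finally show ?thesis using 3 by (simp add: field_simps power2_eq_square power3_eq_cube)
  qed
  then show ?thesis by (simp add: S_def n_def m_def)
qed

section \<open>Controlled sets\<close>

text \<open>Convexity is replaced by its third-moment consequence. The set \<open>B\<close> is left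
  arbitrary because \<open>A\<close>, \<open>difs A A\<close>, the popular differences and sets
  built from them all take its place.\<close>

locale controlled_set =
  fixes A :: "'a::ab_group_add set" and L :: real
  assumes finA [simp]: "finite A" and nonempty [simp]: "A \<noteq> {}" and L1: "L \<ge> 1"
    and control: "\<And>B I. finite B \<Longrightarrow> finite I \<Longrightarrow>
      (\<Sum>x\<in>I. real (rep A B x) ^ 3) \<le> L * real (card A) * real (card B) ^ 2"
begin

abbreviation n :: real where "n \<equiv> real (card A)"
abbreviation m :: real where "m \<equiv> real (card (difs A A))"

text \<open>The threshold is one eighth of \<open>n ^ 2 / m\<close>, the average of
  \<open>rep A A\<close> over \<open>difs A A\<close>.\<close>

definition popular :: "'a set" where
  "popular = {t \<in> difs A A. n ^ 2 / (8 * m) \<le> real (rep A A t)}"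

lemma n_pos: "n > 0"
  using nonempty by (simp add: card_gt_0_iff)

lemma difs_nonempty [simp]: "difs A A \<noteq> {}"
  using nonempty by (auto simp: difs_def)

lemma m_pos: "m > 0"
  using difs_nonempty by (simp add: card_gt_0_iff)

lemma finite_popular [simp]: "finite popular"
  by (simp add: popular_def)

lemma card_popular_le: "real (card popular) \<le> m"
  unfolding popular_def by (intro of_nat_mono card_mono) auto

section \<open>Energy estimates from the cubic bound\<close>

text \<open>The second moment is interpolated between the first, equal to \<open>n * card B\<close>,
  and the third, bounded by \<open>control\<close>.\<close>

lemma energy_square_le:
  assumes [simp]: "finite B"
  shows "real (energy A B) ^ 2 \<le> L * n ^ 2 * real (card B) ^ 3"
proof -
  have "real (energy A B) ^ 2 = (\<Sum>x\<in>difs A B. real (rep A B x) ^ 2) ^ 2"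
    by (simp add: energy_def)
  also have "\<dots> \<le> (\<Sum>x\<in>difs A B. real (rep A B x)) * (\<Sum>x\<in>difs A B. real (rep A B x) ^ 3)"
    by (rule sum_square_square_le) simp
  also have "(\<Sum>x\<in>difs A B. real (rep A B x)) = n * real (card B)"
    using sum_rep_difs[of A B] by (simp flip: of_nat_sum)
  also have "n * real (card B) * (\<Sum>x\<in>difs A B. real (rep A B x) ^ 3)
      \<le> n * real (card B) * (L * n * real (card B) ^ 2)"
    by (intro mult_left_mono control) auto
  finally show ?thesis by (simp add: power2_eq_square power3_eq_cube mult_ac)
qed

text \<open>The weight \<open>rep A A t\<close> is at least \<open>c\<close> on \<open>V\<close>;
  inserting it turns a count of pairs in \<open>B\<close> into an energy, to which
  \<open>control\<close> applies.\<close>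

lemma sum_mult_rep_le_energy:
  assumes "finite B" "V \<subseteq> difs A A" and c: "\<And>t. t \<in> V \<Longrightarrow> c \<le> real (rep A A t)"
  shows "c * real (\<Sum>t\<in>V. rep B B t) \<le> real (energy A B)"
proof -
  have V: "finite V" using assms finite_subset by fastforce
  have "c * real (\<Sum>t\<in>V. rep B B t) = (\<Sum>t\<in>V. c * real (rep B B t))"
    by (simp add: sum_distrib_left)
  also have "\<dots> \<le> (\<Sum>t\<in>V. real (rep A A t) * real (rep B B t))"
    using c by (intro sum_mono mult_right_mono) auto
  also have "\<dots> = real (\<Sum>t\<in>V. rep A A t * rep B B t)" by simp
  also have "\<dots> \<le> real (energy A B)"
    using sum_rep_mult_rep_le_energy[OF finA assms(1) V] by (simp only: of_nat_le_iff)
  finally show ?thesis .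
qed

text \<open>The pair count is at most \<open>rep A A u ^ 2\<close>, so \<open>control\<close> with
  \<open>B = A\<close> bounds the collisions.\<close>

lemma sum_pairs_mult_rep_le:
  "real (\<Sum>u\<in>difs A A. card {(a, b). a \<in> A \<and> b \<in> A \<and> a - u \<in> A \<and> b - u \<in> A \<and> a - b \<in> V} * rep A A u)
     \<le> L * n ^ 3"
proof -
  have "real (\<Sum>u\<in>difs A A. card {(a, b). a \<in> A \<and> b \<in> A \<and> a - u \<in> A \<and> b - u \<in> A \<and> a - b \<in> V} * rep A A u)
      \<le> real (\<Sum>u\<in>difs A A. rep A A u ^ 2 * rep A A u)"
    by (intro of_nat_mono sum_mono mult_right_mono card_pairs_le_rep_square) auto
  also have "\<dots> = (\<Sum>u\<in>difs A A. real (rep A A u) ^ 3)"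
    by (simp add: power2_eq_square power3_eq_cube)
  also have "\<dots> \<le> L * n * n ^ 2" by (intro control) auto
  finally show ?thesis by (simp add: power2_eq_square power3_eq_cube mult_ac)
qed

lemma card_pairs_unpopular_le: "real (card {(a, b). a \<in> A \<and> b \<in> A \<and> a - b \<notin> popular}) \<le> n ^ 2 / 8"
proof -
  have "{(a, b). a \<in> A \<and> b \<in> A \<and> a - b \<notin> popular} = {(a, b). a \<in> A \<and> b \<in> A \<and> a - b \<in> difs A A - popular}"
    by (auto intro: difsI)
  then have "real (card {(a, b). a \<in> A \<and> b \<in> A \<and> a - b \<notin> popular}) = (\<Sum>t\<in>difs A A - popular. real (rep A A t))"
    by (simp add: sum_rep_eq_card flip: of_nat_sum)
  also have "\<dots> \<le> (\<Sum>t\<in>difs A A - popular. n ^ 2 / (8 * m))"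
    by (intro sum_mono) (auto simp: popular_def)
  also have "\<dots> \<le> (\<Sum>t\<in>difs A A. n ^ 2 / (8 * m))"
    by (intro sum_mono2) auto
  also have "\<dots> = n ^ 2 / 8" by simp
  finally show ?thesis .
qed

text \<open>Most triples of \<open>A\<close> have all three differences popular. They have few
  collisions under \<open>(a, b, c) \<mapsto> (a - c, b - c)\<close>, hence many images; as
  \<open>a - b\<close> is popular too, these images force a large energy.\<close>

lemma energy_popular_lower: "n ^ 5 \<le> 32 * L * m * real (energy A popular)"
proof -
  let ?U = "{(a, b). a \<in> A \<and> b \<in> A \<and> a - b \<notin> popular}"
  have finU: "finite ?U" by (rule finite_subset[of _ "A \<times> A"]) auto
  define S where "S = {(a, b, c). a \<in> A \<and> b \<in> A \<and> c \<in> A \<and> a - c \<in> popular \<and> b - c \<in> popular \<and> a - b \<in> popular}"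
  have finS: "finite S" by (rule finite_subset[of _ "A \<times> A \<times> A"]) (auto simp: S_def)
  \<comment> \<open>These sets cover the triples whose pair \<open>(a, b)\<close>,
    \<open>(a, c)\<close> or \<open>(b, c)\<close> is unpopular, at most \<open>n ^ 3 / 8\<close>
    triples each.\<close>
  let ?B1 = "(\<lambda>(p, c). (fst p, snd p, c)) ` (?U \<times> A)"
  let ?B2 = "(\<lambda>(p, c). (fst p, c, snd p)) ` (?U \<times> A)"
  let ?B3 = "(\<lambda>(p, c). (c, fst p, snd p)) ` (?U \<times> A)"
  have cB: "card ?B1 \<le> card ?U * card A" "card ?B2 \<le> card ?U * card A" "card ?B3 \<le> card ?U * card A"
    using finU card_image_le[of "?U \<times> A"] by (auto simp: card_cartesian_product)
  have "A \<times> A \<times> A \<subseteq> S \<union> (?B1 \<union> (?B2 \<union> ?B3))"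
    by (auto simp: S_def image_iff)
  then have "card (A \<times> A \<times> A) \<le> card (S \<union> (?B1 \<union> (?B2 \<union> ?B3)))"
    using finU finS by (intro card_mono) auto
  also have "\<dots> \<le> card S + (card ?B1 + (card ?B2 + card ?B3))"
    by (meson card_Un_le add_left_mono order_trans)
  also have "\<dots> \<le> card S + 3 * (card ?U * card A)" using cB by simp
  finally have "card A * (card A * card A) \<le> card S + 3 * (card ?U * card A)"
    by (simp add: card_cartesian_product)
  then have "real (card A * (card A * card A)) \<le> real (card S + 3 * (card ?U * card A))"
    by (simp only: of_nat_le_iff)
  then have "n * (n * n) \<le> real (card S) + 3 * (real (card ?U) * n)" by simp
  also have "\<dots> \<le> real (card S) + 3 * (n ^ 2 / 8 * n)"
    using card_pairs_unpopular_le by (intro add_left_mono mult_left_mono mult_right_mono) auto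
  finally have S_ge: "5 / 8 * n ^ 3 \<le> real (card S)"
    by (simp add: power2_eq_square power3_eq_cube)
  have "real (card S) ^ 2 \<le> real (\<Sum>t\<in>popular. rep popular popular t) *
     real (\<Sum>u\<in>difs A A. card {(a, b). a \<in> A \<and> b \<in> A \<and> a - u \<in> A \<and> b - u \<in> A \<and> a - b \<in> popular} * rep A A u)"
    by (rule card_triples_square_le) (auto simp: S_def)
  also have "\<dots> \<le> real (\<Sum>t\<in>popular. rep popular popular t) * (L * n ^ 3)"
    by (intro mult_left_mono sum_pairs_mult_rep_le of_nat_0_le_iff)
  finally have "real (card S) ^ 2 \<le> real (\<Sum>t\<in>popular. rep popular popular t) * (L * n ^ 3)" .
  moreover have "(5 / 8 * n ^ 3) ^ 2 \<le> real (card S) ^ 2"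
    using S_ge n_pos by (intro power_mono) auto
  ultimately have "25 / 64 * n ^ 6 \<le> real (\<Sum>t\<in>popular. rep popular popular t) * (L * n ^ 3)"
    by (simp add: power_mult_distrib power2_eq_square)
  then have "n ^ 3 * (25 / 64 * n ^ 3) \<le> n ^ 3 * (L * real (\<Sum>t\<in>popular. rep popular popular t))"
    by (simp add: mult_ac flip: power_add)
  then have K: "25 / 64 * n ^ 3 \<le> L * real (\<Sum>t\<in>popular. rep popular popular t)"
    using n_pos by (subst (asm) mult_le_cancel_left_pos) auto
  have E: "n ^ 2 / (8 * m) * real (\<Sum>t\<in>popular. rep popular popular t) \<le> real (energy A popular)"
    by (rule sum_mult_rep_le_energy) (auto simp: popular_def)
  have "n ^ 2 * (25 / 64 * n ^ 3) \<le> n ^ 2 * (L * real (\<Sum>t\<in>popular. rep popular popular t))"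
    using K by (intro mult_left_mono) auto
  also have "\<dots> = L * (8 * m) * (n ^ 2 / (8 * m) * real (\<Sum>t\<in>popular. rep popular popular t))"
    using m_pos by simp
  also have "\<dots> \<le> L * (8 * m) * real (energy A popular)"
    using L1 by (intro mult_left_mono E) auto
  finally have "25 / 64 * n ^ 5 \<le> 8 * L * m * real (energy A popular)"
    by (simp add: mult_ac flip: power_add)
  \<comment> \<open>Positivity allows rounding the constant \<open>8 * 64 / 25\<close> up to 32, a
    power of two.\<close>
  moreover have "n ^ 5 > 0" using n_pos by simp
  ultimately show ?thesis by linarith
qed

text \<open>The same collision count with \<open>c\<close> free in \<open>A\<close>: the images are
  pairs in \<open>difs A A\<close> with difference in \<open>V\<close>, and \<open>T\<close> bounds
  \<open>rep A A\<close> from below on \<open>V\<close>, so the energy of \<open>A\<close> and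
  \<open>difs A A\<close> controls them.\<close>

lemma sum_rep_large_le:
  assumes "T > 0" and V: "V = {t \<in> difs A A. T < real (rep A A t)}"
  shows "T ^ 2 * (\<Sum>t\<in>V. real (rep A A t)) ^ 4 \<le> L ^ 3 * n ^ 4 * m ^ 3"
proof -
  define S where "S = {(a, b, c). a \<in> A \<and> b \<in> A \<and> c \<in> A \<and> a - b \<in> V}"
  have finV: "finite V" unfolding V by simp
  define g where "g = (\<Sum>t\<in>V. real (rep A A t))"
  define W where "W = real (\<Sum>t\<in>V. rep (difs A A) (difs A A) t)"
  have "card S = card ({(a, b). a \<in> A \<and> b \<in> A \<and> a - b \<in> V} \<times> A)"
    by (rule bij_betw_same_card[of "\<lambda>(a, b, c). ((a, b), c)"],
        rule bij_betw_byWitness[where f' = "\<lambda>((a, b), c). (a, b, c)"]) (auto simp: S_def)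
  then have cS: "real (card S) = g * n"
    by (simp add: card_cartesian_product g_def sum_rep_eq_card finV flip: of_nat_sum)
  have "real (card S) ^ 2 \<le> W *
     real (\<Sum>u\<in>difs A A. card {(a, b). a \<in> A \<and> b \<in> A \<and> a - u \<in> A \<and> b - u \<in> A \<and> a - b \<in> V} * rep A A u)"
    unfolding W_def by (rule card_triples_square_le) (auto simp: S_def finV intro: difsI)
  also have "\<dots> \<le> W * (L * n ^ 3)"
    unfolding W_def by (intro mult_left_mono sum_pairs_mult_rep_le of_nat_0_le_iff)
  finally have "n ^ 2 * g ^ 2 \<le> n ^ 2 * (L * n * W)"
    unfolding cS by (simp add: power_mult_distrib power2_eq_square power3_eq_cube mult_ac)
  then have g2: "g ^ 2 \<le> L * n * W" using n_pos by (subst (asm) mult_le_cancel_left_pos) auto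
  have TW: "T * W \<le> real (energy A (difs A A))"
    unfolding W_def by (rule sum_mult_rep_le_energy) (auto simp: V)
  have "T * g ^ 2 \<le> T * (L * n * W)" using g2 \<open>T > 0\<close> by (intro mult_left_mono) auto
  also have "\<dots> \<le> L * n * real (energy A (difs A A))"
    using mult_left_mono[OF TW, of "L * n"] L1 by (simp add: mult_ac)
  finally have "(T * g ^ 2) ^ 2 \<le> (L * n * real (energy A (difs A A))) ^ 2"
    using \<open>T > 0\<close> by (intro power_mono) auto
  also have "\<dots> = L ^ 2 * n ^ 2 * real (energy A (difs A A)) ^ 2" by (simp add: power_mult_distrib)
  also have "\<dots> \<le> L ^ 2 * n ^ 2 * (L * n ^ 2 * m ^ 3)"
    by (intro mult_left_mono energy_square_le) auto
  finally show ?thesis unfolding g_def[symmetric]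
    by (simp add: power_mult_distrib power2_eq_square power3_eq_cube mult_ac eval_nat_numeral)
qed

section \<open>Differences of popular differences\<close>

text \<open>Popularity makes the correlation \<open>J\<close> of \<open>rep A W\<close> and
  \<open>rep A popular\<close> large. Cauchy-Schwarz and Hoelder bound it above by third moments,
  and \<open>control\<close> is applied to both \<open>popular\<close> and \<open>W\<close>.\<close>

lemma popular_level_set_bound:
  assumes k: "k \<ge> 1" and finI: "finite I"
  shows "real k ^ 6 * real (card {u \<in> I. k \<le> rep popular popular u}) \<le> 8 ^ 6 * L ^ 3 * m ^ 10 / n ^ 6"
proof -
  define W where "W = {u \<in> I. k \<le> rep popular popular u}"
  define w where "w = real (card W)"
  have finW: "finite W" using finI by (simp add: W_def)
  let ?Y = "difs A popular"
  define J where "J = (\<Sum>y\<in>?Y. real (rep A W y) * real (rep A popular y))"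
  have w0: "w \<ge> 0" by (simp add: w_def)
  \<comment> \<open>Each representation of \<open>v\<close> as a difference of popular elements
    involves a popular \<open>x - v\<close>, which itself has at least
    \<open>n ^ 2 / (8 * m)\<close> representations in \<open>A\<close>.\<close>
  have "n ^ 2 / (8 * m) * (real k * w) = (\<Sum>v\<in>W. n ^ 2 / (8 * m) * real k)"
    by (simp add: w_def)
  also have "\<dots> \<le> (\<Sum>v\<in>W. n ^ 2 / (8 * m) * real (rep popular popular v))"
    by (intro sum_mono mult_left_mono) (auto simp: W_def)
  also have "\<dots> \<le> (\<Sum>v\<in>W. \<Sum>x\<in>popular. real (rep A A (x - v)))"
  proof (intro sum_mono)
    fix v
    have "n ^ 2 / (8 * m) * real (rep popular popular v) = (\<Sum>x\<in>{x \<in> popular. x - v \<in> popular}. n ^ 2 / (8 * m))"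
      by (simp add: rep_def)
    also have "\<dots> \<le> (\<Sum>x\<in>{x \<in> popular. x - v \<in> popular}. real (rep A A (x - v)))"
      by (intro sum_mono) (auto simp: popular_def)
    also have "\<dots> \<le> (\<Sum>x\<in>popular. real (rep A A (x - v)))"
      by (intro sum_mono2) auto
    finally show "n ^ 2 / (8 * m) * real (rep popular popular v) \<le> (\<Sum>x\<in>popular. real (rep A A (x - v)))" .
  qed
  also have "\<dots> = real (\<Sum>v\<in>W. \<Sum>x\<in>popular. rep A A (x - v))" by simp
  also have "\<dots> \<le> real (\<Sum>y\<in>?Y. rep A popular y * rep A W y)"
    by (intro of_nat_mono sum_rep_rep_lower finW) auto
  also have "\<dots> = J" by (simp add: J_def mult.commute)
  finally have J_ge: "n ^ 2 / (8 * m) * (real k * w) \<le> J" .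
  have s1: "(\<Sum>y\<in>?Y. real (rep A W y)) \<le> n * w"
  proof -
    have "(\<Sum>y\<in>?Y. rep A W y) \<le> card A * card W" using finW by (intro sum_rep_le) auto
    then have "real (\<Sum>y\<in>?Y. rep A W y) \<le> real (card A * card W)" by (simp only: of_nat_le_iff)
    then show ?thesis by (simp add: w_def)
  qed
  have s2: "(\<Sum>y\<in>?Y. real (rep A popular y) ^ 3) \<le> L * n * m ^ 2"
  proof -
    have "(\<Sum>y\<in>?Y. real (rep A popular y) ^ 3) \<le> L * n * real (card popular) ^ 2"
      by (intro control) auto
    also have "\<dots> \<le> L * n * m ^ 2"
      using L1 card_popular_le by (intro mult_left_mono power_mono) auto
    finally show ?thesis .
  qed
  have s3: "(\<Sum>y\<in>?Y. real (rep A W y) ^ 3) \<le> L * n * w ^ 2"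
    unfolding w_def by (intro control finW) auto
  define K where "K = (\<Sum>y\<in>?Y. real (rep A W y) * real (rep A popular y) ^ 2)"
  have K0: "K \<ge> 0" by (auto simp: K_def intro!: sum_nonneg)
  have J2: "J ^ 2 \<le> n * w * K"
  proof -
    have "J ^ 2 \<le> (\<Sum>y\<in>?Y. real (rep A W y)) * K"
      unfolding J_def K_def by (rule sum_mult_square_square_le) simp
    also have "\<dots> \<le> n * w * K" using s1 K0 by (intro mult_right_mono)
    finally show ?thesis .
  qed
  have "K ^ 3 \<le> (\<Sum>y\<in>?Y. real (rep A popular y) ^ 3) ^ 2 * (\<Sum>y\<in>?Y. real (rep A W y) ^ 3)"
    unfolding K_def mult.commute[of "real (rep A W _)"] by (rule Hoelder_sum_square_mult) auto
  also have "\<dots> \<le> (L * n * m ^ 2) ^ 2 * (L * n * w ^ 2)"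
    using s2 s3 by (intro mult_mono power_mono sum_nonneg) auto
  finally have K3: "K ^ 3 \<le> (L * n * m ^ 2) ^ 2 * (L * n * w ^ 2)" .
  have "(n ^ 2 / (8 * m) * (real k * w)) ^ 6 \<le> J ^ 6"
    using J_ge w0 by (intro power_mono) auto
  also have "J ^ 6 = (J ^ 2) ^ 3" by (simp flip: power_mult)
  also have "\<dots> \<le> (n * w * K) ^ 3" using J2 by (intro power_mono) auto
  also have "\<dots> = (n * w) ^ 3 * K ^ 3" by (simp add: power_mult_distrib)
  also have "\<dots> \<le> (n * w) ^ 3 * ((L * n * m ^ 2) ^ 2 * (L * n * w ^ 2))"
    using K3 w0 by (intro mult_left_mono) auto
  also have "\<dots> = L ^ 3 * n ^ 6 * m ^ 4 * w ^ 5"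
    by (simp add: power_mult_distrib power2_eq_square eval_nat_numeral mult_ac)
  finally have main: "(n ^ 2 / (8 * m)) ^ 6 * (real k ^ 6 * w ^ 6) \<le> L ^ 3 * n ^ 6 * m ^ 4 * w ^ 5"
    by (simp only: power_mult_distrib)
  show ?thesis
  proof (cases "w = 0")
    case True
    then show ?thesis using L1 by (simp add: w_def W_def)
  next
    case False
    then have w: "w > 0" using w0 by simp
    \<comment> \<open>The two sides of \<open>main\<close> carry \<open>w ^ 6\<close> and
      \<open>w ^ 5\<close>; cancelling leaves a bound for \<open>w\<close> itself.\<close>
    have "w ^ 5 * ((n ^ 2 / (8 * m)) ^ 6 * (real k ^ 6 * w)) \<le> w ^ 5 * (L ^ 3 * n ^ 6 * m ^ 4)"
      using main by (simp add: eval_nat_numeral mult_ac)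
    then have "(n ^ 2 / (8 * m)) ^ 6 * (real k ^ 6 * w) \<le> L ^ 3 * n ^ 6 * m ^ 4"
      using w by (subst (asm) mult_le_cancel_left_pos) auto
    then have "n ^ 12 * (real k ^ 6 * w) \<le> 8 ^ 6 * L ^ 3 * m ^ 10 * n ^ 6"
    proof -
      have "(n ^ 2 / (8 * m)) ^ 6 = n ^ 12 / (8 * m) ^ 6" by (simp add: power_divide flip: power_mult)
      then have "n ^ 12 * (real k ^ 6 * w) / (8 * m) ^ 6 \<le> L ^ 3 * n ^ 6 * m ^ 4"
        using \<open>(n ^ 2 / (8 * m)) ^ 6 * (real k ^ 6 * w) \<le> _\<close> by simp
      then have "n ^ 12 * (real k ^ 6 * w) \<le> L ^ 3 * n ^ 6 * m ^ 4 * (8 * m) ^ 6"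
        using m_pos by (subst (asm) pos_divide_le_eq) auto
      also have "\<dots> = 8 ^ 6 * L ^ 3 * m ^ 10 * n ^ 6"
        by (simp add: power_mult_distrib mult_ac flip: power_add)
      finally show ?thesis .
    qed
    then have "n ^ 6 * (n ^ 6 * (real k ^ 6 * w)) \<le> n ^ 6 * (8 ^ 6 * L ^ 3 * m ^ 10)"
    proof -
      have "n ^ 12 = n ^ 6 * n ^ 6" by (simp flip: power_add)
      then show ?thesis using \<open>n ^ 12 * (real k ^ 6 * w) \<le> _\<close> by (simp only: mult_ac)
    qed
    then have "n ^ 6 * (real k ^ 6 * w) \<le> 8 ^ 6 * L ^ 3 * m ^ 10"
      using n_pos by (subst (asm) mult_le_cancel_left_pos) auto
    then show ?thesis using n_pos by (simp add: w_def W_def field_simps)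
  qed
qed

lemma sum_rep_popular_power6:
  assumes "finite I"
  shows "(\<Sum>u\<in>I. real (rep popular popular u) ^ 6)
     \<le> 6 * (8 ^ 6 * L ^ 3 * m ^ 10 / n ^ 6) * harm (card (difs A A))"
proof -
  have "rep popular popular u \<le> card (difs A A)" for u
    using rep_le_card[of popular popular u] card_popular_le by simp
  then show ?thesis
    using sum_power_le_level_sets[OF assms, of 6 "rep popular popular" "card (difs A A)" "8 ^ 6 * L ^ 3 * m ^ 10 / n ^ 6"]
      popular_level_set_bound assms by simp
qed


section \<open>Combination of the estimates\<close>

text \<open>Doubled and exponentiated, the conclusion bounds \<open>n ^ 1026\<close> by
  \<open>2 ^ 1590 * L ^ 387 * m ^ 641\<close>. Logarithms make the elimination of all intermediate
  quantities linear.\<close>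

lemma card_difs_power_bound:
  assumes hm: "harm (card (difs A A)) \<le> L"
  shows "513 * ln n \<le> 641/2 * ln m + 387/2 * ln L + 795 * ln 2"
proof -
  define X where "X = popular"
  define E where "E = real (energy A X)"
  define r where "r y = real (rep A X y)" for y
  let ?Y = "difs A X"
  have finX [simp]: "finite X" by (simp add: X_def)
  have Xm: "real (card X) \<le> m" using card_popular_le by (simp add: X_def)
  have E_ge: "n ^ 5 \<le> 32 * L * m * E" using energy_popular_lower by (simp add: E_def X_def)
  have Lp: "L > 0" using L1 by simp
  have Ep: "E > 0"
  proof (rule ccontr)
    assume "\<not> E > 0"
    then have "E = 0" by (simp add: E_def)
    then show False using E_ge n_pos by simp
  qed
  have r0: "r y \<ge> 0" for y by (simp add: r_def)
  have sr: "(\<Sum>y\<in>?Y. r y) \<le> n * m"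
  proof -
    have "(\<Sum>y\<in>?Y. r y) = n * real (card X)"
      using sum_rep_difs[OF finA finX] by (simp add: r_def flip: of_nat_sum)
    then show ?thesis using Xm by (simp add: mult_left_mono)
  qed
  have sr2: "(\<Sum>y\<in>?Y. r y ^ 2) = E" by (simp add: r_def E_def energy_def)
  have sr3: "(\<Sum>y\<in>?Y. r y ^ 3) \<le> L * n * m ^ 2"
  proof -
    have "(\<Sum>y\<in>?Y. r y ^ 3) \<le> L * n * real (card X) ^ 2"
      unfolding r_def by (intro control) auto
    also have "\<dots> \<le> L * n * m ^ 2" using Lp Xm by (intro mult_left_mono power_mono) auto
    finally show ?thesis .
  qed
  \<comment> \<open>Since \<open>r\<close> sums to at most \<open>n * m\<close>, values below
    \<open>\<tau>\<close> contribute at most \<open>E / 2\<close> to the energy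
    \<open>E\<close>.\<close>
  define \<tau> where "\<tau> = E / (2 * n * m)"
  have \<tau>p: "\<tau> > 0" using Ep n_pos m_pos by (simp add: \<tau>_def)
  define Q where "Q = {y \<in> ?Y. \<tau> \<le> r y}"
  have finQ [simp]: "finite Q" by (simp add: Q_def)
  have QY: "Q \<subseteq> ?Y" by (auto simp: Q_def)
  define q where "q = real (card Q)"
  have SQ2: "E / 2 \<le> (\<Sum>y\<in>Q. r y ^ 2)"
  proof -
    have "(\<Sum>y\<in>?Y - Q. r y ^ 2) \<le> (\<Sum>y\<in>?Y - Q. \<tau> * r y)"
      by (intro sum_mono) (auto simp: Q_def power2_eq_square intro!: mult_right_mono r0)
    also have "\<dots> \<le> (\<Sum>y\<in>?Y. \<tau> * r y)"
      using \<tau>p r0 by (intro sum_mono2) auto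
    also have "\<dots> \<le> \<tau> * (n * m)"
      using \<tau>p sr by (simp add: mult_left_mono flip: sum_distrib_left)
    also have "\<dots> = E / 2" by (simp add: \<tau>_def)
    finally have "(\<Sum>y\<in>?Y - Q. r y ^ 2) \<le> E / 2" .
    moreover have "(\<Sum>y\<in>?Y. r y ^ 2) = (\<Sum>y\<in>?Y - Q. r y ^ 2) + (\<Sum>y\<in>Q. r y ^ 2)"
      using QY by (intro sum.subset_diff) auto
    ultimately show ?thesis using sr2 by simp
  qed
  have SQ3: "(\<Sum>y\<in>Q. r y ^ 3) \<le> L * n * m ^ 2"
  proof -
    have "(\<Sum>y\<in>Q. r y ^ 3) \<le> (\<Sum>y\<in>?Y. r y ^ 3)"
      using QY r0 by (intro sum_mono2) auto
    then show ?thesis using sr3 by simp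
  qed
  \<comment> \<open>Markov's inequality for the third moment of \<open>r\<close>.\<close>
  have q_le: "q * E ^ 3 \<le> 8 * L * n ^ 4 * m ^ 5"
  proof -
    have "q * \<tau> ^ 3 = (\<Sum>y\<in>Q. \<tau> ^ 3)" by (simp add: q_def)
    also have "\<dots> \<le> (\<Sum>y\<in>Q. r y ^ 3)"
      using \<tau>p by (intro sum_mono power_mono) (auto simp: Q_def)
    also have "\<dots> \<le> L * n * m ^ 2" by (rule SQ3)
    finally have "q * E ^ 3 \<le> L * n * m ^ 2 * (2 * n * m) ^ 3"
      using n_pos m_pos by (simp add: \<tau>_def power_divide divide_le_eq)
    then show ?thesis by (simp add: power_mult_distrib eval_nat_numeral mult_ac)
  qed
  define S where "S = (\<Sum>y\<in>Q. r y)"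
  have S0: "S \<ge> 0" unfolding S_def using r0 by (intro sum_nonneg) auto
  have S_ge: "E ^ 2 / (4 * L * n * m ^ 2) \<le> S"
  proof -
    have "(E / 2) ^ 2 \<le> (\<Sum>y\<in>Q. r y ^ 2) ^ 2" using SQ2 Ep by (intro power_mono) auto
    also have "\<dots> \<le> S * (\<Sum>y\<in>Q. r y ^ 3)"
      unfolding S_def by (rule sum_square_square_le) (rule r0)
    also have "\<dots> \<le> S * (L * n * m ^ 2)" using SQ3 S0 by (intro mult_left_mono)
    finally have "E ^ 2 \<le> S * (4 * L * n * m ^ 2)" by (simp add: power_divide mult_ac)
    then show ?thesis using Lp n_pos m_pos by (subst pos_divide_le_eq) auto
  qed
  \<comment> \<open>This is the square of the lower bound for \<open>S\<close>, divided by
    \<open>m\<close>: Cauchy-Schwarz over \<open>x \<in> X\<close> yields at least \<open>M\<close>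
    triples \<open>(a, b, x)\<close> with \<open>a - x\<close> and \<open>b - x\<close> in
    \<open>Q\<close>.\<close>
  define M where "M = E ^ 4 / (16 * L ^ 2 * n ^ 2 * m ^ 5)"
  have Mp: "M > 0" using Ep Lp n_pos m_pos by (simp add: M_def)
  define c where "c x = real (card {a \<in> A. a - x \<in> Q})" for x
  have M_le: "M \<le> (\<Sum>x\<in>X. c x ^ 2)"
  proof -
    have "S = (\<Sum>x\<in>X. c x)"
    proof -
      have "S = real (card {(a, x). a \<in> A \<and> x \<in> X \<and> a - x \<in> Q})"
        unfolding S_def r_def by (simp add: sum_rep_eq_card flip: of_nat_sum)
      also have "card {(a, x). a \<in> A \<and> x \<in> X \<and> a - x \<in> Q} = card (SIGMA x:X. {a \<in> A. a - x \<in> Q})"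
        by (rule bij_betw_same_card[of prod.swap],
            rule bij_betw_byWitness[where f' = prod.swap]) auto
      also have "\<dots> = (\<Sum>x\<in>X. card {a \<in> A. a - x \<in> Q})" by (subst card_SigmaI) auto
      finally show ?thesis by (simp add: c_def)
    qed
    then have "S ^ 2 \<le> (\<Sum>x\<in>X. 1 ^ 2) * (\<Sum>x\<in>X. c x ^ 2)"
      using Cauchy_Schwarz_ineq_sum[of "\<lambda>_. 1" c X] by simp
    also have "\<dots> \<le> m * (\<Sum>x\<in>X. c x ^ 2)"
      using Xm by (intro mult_right_mono sum_nonneg) auto
    finally have "S ^ 2 \<le> m * (\<Sum>x\<in>X. c x ^ 2)" .
    moreover have "(E ^ 2 / (4 * L * n * m ^ 2)) ^ 2 \<le> S ^ 2"
      using S_ge Ep Lp by (intro power_mono) auto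
    moreover have "(E ^ 2 / (4 * L * n * m ^ 2)) ^ 2 = m * M"
      using m_pos Lp n_pos by (simp add: M_def power_divide power_mult_distrib field_simps eval_nat_numeral)
    ultimately have "m * M \<le> m * (\<Sum>x\<in>X. c x ^ 2)" by linarith
    then show ?thesis using m_pos by simp
  qed
  \<comment> \<open>\<open>T0\<close> and \<open>T\<close> are chosen so that the pairs with difference outside \<open>P\<close> account for at most half of
    the \<open>M\<close> triples.\<close>
  define T0 where "T0 = M / (4 * m ^ 2)"
  define T where "T = sqrt (256 * L ^ 3 * n ^ 4 * m ^ 7 / M ^ 4)"
  have T0p: "T0 > 0" using Mp m_pos by (simp add: T0_def)
  have Tp: "T > 0" using Lp n_pos m_pos Mp by (simp add: T_def)
  have T2: "T ^ 2 = 256 * L ^ 3 * n ^ 4 * m ^ 7 / M ^ 4"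
    using Lp n_pos m_pos Mp by (simp add: T_def)
  define P where "P = {t \<in> difs A A. T0 \<le> real (rep A A t) \<and> real (rep A A t) \<le> T}"
  have finP [simp]: "finite P" by (simp add: P_def)
  define bad where "bad = real (card {(a, b). a \<in> A \<and> b \<in> A \<and> a - b \<in> difs A A - P})"
  have bad: "bad \<le> M / (2 * m)"
  proof -
    let ?V1 = "{t \<in> difs A A. real (rep A A t) < T0}"
    let ?V2 = "{t \<in> difs A A. T < real (rep A A t)}"
    have "bad = (\<Sum>t\<in>difs A A - P. real (rep A A t))"
      unfolding bad_def by (simp add: sum_rep_eq_card flip: of_nat_sum)
    also have "\<dots> \<le> (\<Sum>t\<in>?V1 \<union> ?V2. real (rep A A t))"
      by (intro sum_mono2) (auto simp: P_def)
    also have "\<dots> \<le> (\<Sum>t\<in>?V1. real (rep A A t)) + (\<Sum>t\<in>?V2. real (rep A A t))"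
      by (subst sum_Un) (auto intro!: sum_nonneg)
    also have "(\<Sum>t\<in>?V1. real (rep A A t)) \<le> M / (4 * m)"
    proof -
      have "(\<Sum>t\<in>?V1. real (rep A A t)) \<le> (\<Sum>t\<in>?V1. T0)" by (intro sum_mono) auto
      also have "\<dots> \<le> (\<Sum>t\<in>difs A A. T0)" using T0p by (intro sum_mono2) auto
      also have "\<dots> = m * T0" by simp
      also have "\<dots> = M / (4 * m)" using m_pos by (simp add: T0_def power2_eq_square)
      finally show ?thesis .
    qed
    also have "(\<Sum>t\<in>?V2. real (rep A A t)) \<le> M / (4 * m)"
    proof -
      have "T ^ 2 * (\<Sum>t\<in>?V2. real (rep A A t)) ^ 4 \<le> L ^ 3 * n ^ 4 * m ^ 3"
        by (rule sum_rep_large_le[OF Tp refl])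
      also have "\<dots> = T ^ 2 * (M / (4 * m)) ^ 4"
        unfolding T2 using Mp m_pos by (simp add: power_divide power_mult_distrib field_simps eval_nat_numeral)
      finally have "(\<Sum>t\<in>?V2. real (rep A A t)) ^ 4 \<le> (M / (4 * m)) ^ 4"
        using Tp by simp
      moreover have "0 \<le> (\<Sum>t\<in>?V2. real (rep A A t))" "0 \<le> M / (4 * m)"
        using Mp by (auto intro: sum_nonneg)
      ultimately show ?thesis by (subst (asm) power_mono_iff) auto
    qed
    finally show ?thesis by simp
  qed
  define N where "N = {(a, b, x). a \<in> A \<and> b \<in> A \<and> x \<in> X \<and> a - x \<in> Q \<and> b - x \<in> Q \<and> a - b \<in> P}"
  have finN: "finite N" by (rule finite_subset[of _ "A \<times> A \<times> X"]) (auto simp: N_def)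
  \<comment> \<open>Each pair with difference outside \<open>P\<close> spoils at most
    \<open>card X\<close> triples, and \<open>card X \<le> m\<close>; by \<open>bad\<close> this
    removes at most \<open>M / 2\<close>.\<close>
  have N_ge: "M / 2 \<le> real (card N)"
  proof -
    let ?all = "SIGMA x:X. {a \<in> A. a - x \<in> Q} \<times> {a \<in> A. a - x \<in> Q}"
    let ?f = "\<lambda>(a, b, x). (x, a, b)"
    let ?bad = "X \<times> {(a, b). a \<in> A \<and> b \<in> A \<and> a - b \<in> difs A A - P}"
    have finb: "finite {(a, b). a \<in> A \<and> b \<in> A \<and> a - b \<in> difs A A - P}"
      by (rule finite_subset[of _ "A \<times> A"]) auto
    have "?all \<subseteq> ?f ` N \<union> ?bad"
      by (auto simp: N_def image_iff intro: difsI)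
    then have "card ?all \<le> card (?f ` N \<union> ?bad)"
      using finN finb by (intro card_mono) auto
    also have "\<dots> \<le> card (?f ` N) + card ?bad" by (rule card_Un_le)
    also have "\<dots> \<le> card N + card ?bad" using finN by (intro add_right_mono card_image_le)
    finally have "real (card ?all) \<le> real (card N) + real (card ?bad)"
      by (simp only: of_nat_le_iff flip: of_nat_add)
    moreover have "real (card ?all) = (\<Sum>x\<in>X. c x ^ 2)"
      by (subst card_SigmaI) (auto simp: card_cartesian_product c_def power2_eq_square)
    moreover have "real (card ?bad) \<le> M / 2"
    proof -
      have "real (card ?bad) = real (card X) * bad" by (simp add: card_cartesian_product bad_def)
      also have "\<dots> \<le> m * (M / (2 * m))"
        using Xm bad by (intro mult_mono) (auto simp: bad_def)
      finally show ?thesis using m_pos by simp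
    qed
    ultimately show ?thesis using M_le by linarith
  qed
  define p where "p u = real (card {(a, b). a \<in> A \<and> b \<in> A \<and> a - u \<in> A \<and> b - u \<in> A \<and> a - b \<in> P})" for u
  define h where "h u = real (rep X X u)" for u
  define R where "R = real (\<Sum>t\<in>P. rep Q Q t)"
  define F where "F = (\<Sum>u\<in>difs A A. p u * h u)"
  have p0: "p u \<ge> 0" and h0: "h u \<ge> 0" for u by (simp_all add: p_def h_def)
  have RF: "M ^ 2 / 4 \<le> R * F"
  proof -
    have "(M / 2) ^ 2 \<le> real (card N) ^ 2" using N_ge Mp by (intro power_mono) auto
    also have "\<dots> \<le> R * real (\<Sum>u\<in>difs A A. card {(a, b). a \<in> A \<and> b \<in> A \<and> a - u \<in> A \<and> b - u \<in> A \<and> a - b \<in> P} * rep X X u)"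
      unfolding R_def by (rule card_triples_square_le) (auto simp: N_def)
    also have "\<dots> = R * F" by (simp add: F_def p_def h_def)
    finally show ?thesis by (simp add: power_divide)
  qed
  have RT: "R * T0 \<le> real (energy A Q)"
    unfolding R_def mult.commute[of _ T0] by (rule sum_mult_rep_le_energy) (auto simp: P_def)
  have EQ: "real (energy A Q) ^ 2 \<le> L * n ^ 2 * q ^ 3"
    unfolding q_def by (rule energy_square_le) simp
  define H where "H = (\<Sum>u\<in>difs A A. h u ^ 6)"
  have H_le: "H \<le> 6 * (8 ^ 6 * L ^ 3 * m ^ 10 / n ^ 6) * L"
  proof -
    have "H \<le> 6 * (8 ^ 6 * L ^ 3 * m ^ 10 / n ^ 6) * harm (card (difs A A))"
      unfolding H_def h_def X_def by (rule sum_rep_popular_power6) simp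
    also have "\<dots> \<le> 6 * (8 ^ 6 * L ^ 3 * m ^ 10 / n ^ 6) * L"
      using hm Lp by (intro mult_left_mono) auto
    finally show ?thesis .
  qed
  \<comment> \<open>Hoelder with exponents 2, 3 and 6 for \<open>p\<close> to the 1/2,
    \<open>p\<close> to the 1/2, and \<open>h\<close>. The first factor uses
    \<open>rep A A t \<le> T\<close> on \<open>P\<close>, the second
    \<open>sqrt (p u) \<le> rep A A u\<close>, the third is \<open>H\<close>.\<close>
  have F_le: "F ^ 6 \<le> (T * n ^ 2) ^ 3 * ((L * n ^ 3) ^ 2 * H)"
  proof -
    define G where "G = (\<Sum>u\<in>difs A A. p u * h u ^ 2)"
    have G0: "G \<ge> 0" unfolding G_def using p0 by (intro sum_nonneg) auto
    have sp: "(\<Sum>u\<in>difs A A. p u) \<le> T * n ^ 2"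
    proof -
      have "(\<Sum>u\<in>difs A A. p u) \<le> real (\<Sum>t\<in>P. rep A A t ^ 2)"
        unfolding p_def of_nat_sum[symmetric] by (intro of_nat_mono sum_card_pairs_le) auto
      also have "\<dots> = (\<Sum>t\<in>P. real (rep A A t) * real (rep A A t))" by (simp add: power2_eq_square)
      also have "\<dots> \<le> (\<Sum>t\<in>P. T * real (rep A A t))"
        by (intro sum_mono mult_right_mono) (auto simp: P_def)
      also have "\<dots> = T * real (\<Sum>t\<in>P. rep A A t)" by (simp add: sum_distrib_left)
      also have "\<dots> \<le> T * real (card A * card A)"
        using Tp by (intro mult_left_mono of_nat_mono sum_rep_le) auto
      finally show ?thesis by (simp add: power2_eq_square)
    qed
    have F2: "F ^ 2 \<le> T * n ^ 2 * G"
    proof -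
      have "F ^ 2 \<le> (\<Sum>u\<in>difs A A. p u) * G"
        unfolding F_def G_def by (rule sum_mult_square_square_le) (rule p0)
      also have "\<dots> \<le> T * n ^ 2 * G" using sp G0 by (intro mult_right_mono)
      finally show ?thesis .
    qed
    have "G = (\<Sum>u\<in>difs A A. sqrt (p u) ^ 2 * h u ^ 2)"
      unfolding G_def using p0 by simp
    then have "G ^ 3 \<le> (\<Sum>u\<in>difs A A. sqrt (p u) ^ 3) ^ 2 * (\<Sum>u\<in>difs A A. (h u ^ 2) ^ 3)"
      using Hoelder_sum_square_mult[of "difs A A" "\<lambda>u. sqrt (p u)" "\<lambda>u. h u ^ 2"] p0 by simp
    also have "(\<Sum>u\<in>difs A A. (h u ^ 2) ^ 3) = H" by (simp add: H_def flip: power_mult)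
    also have "(\<Sum>u\<in>difs A A. sqrt (p u) ^ 3) ^ 2 * H \<le> (L * n ^ 3) ^ 2 * H"
    proof (intro mult_right_mono power_mono)
      have "sqrt (p u) ^ 3 \<le> p u * real (rep A A u)" for u
      proof -
        have "p u \<le> real (rep A A u) ^ 2"
          unfolding p_def of_nat_power[symmetric] by (intro of_nat_mono card_pairs_le_rep_square) simp
        then have "sqrt (p u) \<le> real (rep A A u)" by (simp add: real_le_lsqrt)
        then have "p u * sqrt (p u) \<le> p u * real (rep A A u)" using p0 by (intro mult_left_mono)
        then show ?thesis using p0[of u] by (simp add: power3_eq_cube)
      qed
      then have "(\<Sum>u\<in>difs A A. sqrt (p u) ^ 3) \<le> (\<Sum>u\<in>difs A A. p u * real (rep A A u))"
        by (intro sum_mono)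
      also have "\<dots> \<le> L * n ^ 3" using sum_pairs_mult_rep_le[of P] by (simp add: p_def)
      finally show "(\<Sum>u\<in>difs A A. sqrt (p u) ^ 3) \<le> L * n ^ 3" .
    qed (auto simp: H_def intro!: sum_nonneg p0 h0)
    finally have G3: "G ^ 3 \<le> (L * n ^ 3) ^ 2 * H" .
    have "F ^ 6 = (F ^ 2) ^ 3" by (simp flip: power_mult)
    also have "\<dots> \<le> (T * n ^ 2 * G) ^ 3" using F2 by (intro power_mono) auto
    also have "\<dots> = (T * n ^ 2) ^ 3 * G ^ 3" by (simp add: power_mult_distrib)
    also have "\<dots> \<le> (T * n ^ 2) ^ 3 * ((L * n ^ 3) ^ 2 * H)"
      using G3 Tp by (intro mult_left_mono) auto
    finally show ?thesis .
  qed
  \<comment> \<open>Strict positivity of every quantity is established before taking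
    logarithms.\<close>
  have "R \<ge> 0" "F \<ge> 0" using p0 h0 by (auto simp: R_def F_def intro!: sum_nonneg)
  moreover have "R * F > 0" using RF Mp by (smt (verit) zero_less_power divide_pos_pos)
  ultimately have Rp: "R > 0" and Fp: "F > 0" by (auto simp: zero_less_mult_iff)
  have eqp: "real (energy A Q) > 0" using RT Rp T0p by (smt (verit) mult_pos_pos)
  have qp: "q > 0"
  proof (rule ccontr)
    assume "\<not> q > 0"
    then have "q = 0" by (simp add: q_def)
    then show False using EQ eqp by simp
  qed
  have Hp: "H > 0"
  proof (rule ccontr)
    assume "\<not> H > 0"
    moreover have "H \<ge> 0" unfolding H_def by (intro sum_nonneg) simp
    ultimately have "H = 0" by simp
    then show False using F_le Fp by simp
  qed
  note pos = n_pos m_pos Lp Ep Mp T0p Tp Rp Fp eqp qp Hp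
  have l32: "ln 32 = 5 * ln (2::real)" using ln_realpow[of 2 5] by simp
  have l16: "ln 16 = 4 * ln (2::real)" using ln_realpow[of 2 4] by simp
  have l256: "ln 256 = 8 * ln (2::real)" using ln_realpow[of 2 8] by simp
  have l8: "ln 8 = 3 * ln (2::real)" using ln_realpow[of 2 3] by simp
  have l4: "ln 4 = 2 * ln (2::real)" using ln_realpow[of 2 2] by simp
  have 1: "5 * ln n \<le> 5 * ln 2 + ln L + ln m + ln E"
  proof -
    have "ln (n ^ 5) \<le> ln (32 * L * m * E)" using E_ge pos by (subst ln_le_cancel_iff) auto
    then show ?thesis using pos by (simp add: ln_mult_pos ln_realpow l32)
  qed
  have 2: "ln q + 3 * ln E \<le> 3 * ln 2 + ln L + 4 * ln n + 5 * ln m"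
  proof -
    have "ln (q * E ^ 3) \<le> ln (8 * L * n ^ 4 * m ^ 5)" using q_le pos by (subst ln_le_cancel_iff) auto
    then show ?thesis using pos by (simp add: ln_mult_pos ln_realpow l8)
  qed
  have 3: "ln M = 4 * ln E - (4 * ln 2 + 2 * ln L + 2 * ln n + 5 * ln m)"
    unfolding M_def using pos by (simp add: ln_mult_pos ln_realpow ln_div l16)
  have 4: "ln T0 = ln M - (2 * ln 2 + 2 * ln m)"
    unfolding T0_def using pos by (simp add: ln_mult_pos ln_realpow ln_div l4)
  have 5: "2 * ln T = 8 * ln 2 + 3 * ln L + 4 * ln n + 7 * ln m - 4 * ln M"
  proof -
    have "2 * ln T = ln (T ^ 2)" using pos by (simp add: ln_realpow)
    also have "\<dots> = 8 * ln 2 + 3 * ln L + 4 * ln n + 7 * ln m - 4 * ln M"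
      unfolding T2 using pos by (simp add: ln_mult_pos ln_realpow ln_div l256)
    finally show ?thesis .
  qed
  have 6: "2 * ln M - 2 * ln 2 \<le> ln R + ln F"
  proof -
    have "ln (M ^ 2 / 4) \<le> ln (R * F)" using RF pos by (subst ln_le_cancel_iff) auto
    then show ?thesis using pos by (simp add: ln_mult_pos ln_realpow ln_div l4)
  qed
  have 7: "ln R + ln T0 \<le> ln (real (energy A Q))"
  proof -
    have "ln (R * T0) \<le> ln (real (energy A Q))" using RT pos by (subst ln_le_cancel_iff) auto
    then show ?thesis using pos by (simp add: ln_mult_pos)
  qed
  have 8: "2 * ln (real (energy A Q)) \<le> ln L + 2 * ln n + 3 * ln q"
  proof -
    have "ln (real (energy A Q) ^ 2) \<le> ln (L * n ^ 2 * q ^ 3)" using EQ pos by (subst ln_le_cancel_iff) auto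
    then show ?thesis using pos by (simp add: ln_mult_pos ln_realpow)
  qed
  have 9: "6 * ln F \<le> 3 * (ln T + 2 * ln n) + (2 * (ln L + 3 * ln n) + ln H)"
  proof -
    have "ln (F ^ 6) \<le> ln ((T * n ^ 2) ^ 3 * ((L * n ^ 3) ^ 2 * H))" using F_le pos by (subst ln_le_cancel_iff) auto
    then show ?thesis using pos by (simp add: ln_mult_pos ln_realpow)
  qed
  have 10: "ln H \<le> 21 * ln 2 + 4 * ln L + 10 * ln m - 6 * ln n"
  proof -
    have l21: "ln 2097152 = 21 * ln (2::real)" using ln_realpow[of 2 21] by simp
    have "H \<le> 1572864 * L ^ 4 * m ^ 10 / n ^ 6" using H_le by (simp add: eval_nat_numeral mult_ac)
    \<comment> \<open>Here \<open>6 * 8 ^ 6 = 1572864\<close> is rounded up to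
      \<open>2 ^ 21\<close>.\<close>
    also have "\<dots> \<le> 2097152 * L ^ 4 * m ^ 10 / n ^ 6"
      using Lp by (intro divide_right_mono mult_right_mono) auto
    finally have "ln H \<le> ln (2097152 * L ^ 4 * m ^ 10 / n ^ 6)" using pos by (subst ln_le_cancel_iff) auto
    then show ?thesis using pos by (simp add: ln_mult_pos ln_realpow ln_div l21)
  qed
  \<comment> \<open>Substitute the equations \<open>3\<close>, \<open>4\<close>, \<open>5\<close>
    and add the inequalities with weights 123 for \<open>1\<close>, 9 for \<open>2\<close>, 6 for
    \<open>6\<close> and \<open>7\<close>, 3 for \<open>8\<close>, and 1 for \<open>9\<close> and
    \<open>10\<close>.\<close>
  from 1 2 3 4 5 6 7 8 9 10 show ?thesis by argo
qed

end

section \<open>The lower bound for convex sets\<close>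

text \<open>The increment satisfies \<open>1 / (k + 1) \<le> ln ((k + 1) / k)\<close>, by
  \<open>ln x \<le> x - 1\<close> at \<open>x = k / (k + 1)\<close>.\<close>

lemma harm_le_ln_plus_1: "k > 0 \<Longrightarrow> harm k \<le> 1 + ln (real k)"
proof (induction k rule: nat_induct_non_zero)
  case (Suc k)
  have "ln (real k / real (Suc k)) \<le> real k / real (Suc k) - 1"
    using Suc by (intro ln_le_minus_one) simp
  also have "\<dots> = - inverse (real (Suc k))" by (simp add: field_simps)
  finally have "inverse (real (Suc k)) \<le> ln (real (Suc k)) - ln (real k)"
    using Suc by (simp add: ln_div)
  then show ?case using Suc by (simp add: harm_Suc)
qed (simp add: harm_def)

text \<open>The constant is \<open>768 = 3 * 256\<close>: the exponent 3 of the layer-cake bound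
  times the constant of the level set bound.\<close>

lemma convex_set_controlled:
  assumes cvx: "convex_set A" and ne: "A \<noteq> {}" and L: "768 * harm (card A) \<le> L"
  shows "controlled_set A L"
proof
  show finA: "finite A" using cvx by (simp add: convex_set_def)
  show "A \<noteq> {}" by (rule ne)
  have "harm 1 \<le> (harm (card A) :: real)"
    using ne finA by (intro harm_mono) (simp add: Suc_le_eq card_gt_0_iff)
  then show "1 \<le> L" using L by (simp add: harm_def)
  fix B :: "real set" and I :: "real set" assume fin: "finite B" "finite I"
  have "(\<Sum>x\<in>I. real (rep A B x) ^ 3) \<le> real 3 * (256 * real (card A) * real (card B) ^ 2) * harm (card A)"
    by (rule sum_power_le_level_sets[OF fin(2)])
      (use finA fin convex_set_level_set_bound[OF cvx] in \<open>auto simp: rep_le_card\<close>)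
  also have "\<dots> = 768 * harm (card A) * real (card A) * real (card B) ^ 2" by simp
  also have "\<dots> \<le> L * real (card A) * real (card B) ^ 2"
    using L by (intro mult_right_mono) auto
  finally show "(\<Sum>x\<in>I. real (rep A B x) ^ 3) \<le> L * real (card A) * real (card B) ^ 2" .
qed

lemma diff_set_eq_difs: "diff_set A = difs A A"
  by (auto simp: diff_set_def difs_def)

text \<open>The exponent \<open>1026/641\<close> exceeds \<open>8/5\<close> by
  \<open>2/3205\<close>; the surplus over \<open>1/3440\<close> absorbs the power of
  \<open>L\<close>.\<close>

lemma card_diff_set_lower:
  assumes cvx: "convex_set A" and ne: "A \<noteq> {}"
  shows "real (card (diff_set A)) \<ge> exp (- (387/641 * ln (768 * 4001) + 1590/641 * ln 2)) * real (card A) powr (8/5 + 1/3440)"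
proof -
  have finA: "finite A" using cvx by (simp add: convex_set_def)
  define K :: real where "K = 387/641 * ln (768 * 4001) + 1590/641 * ln 2"
  define n where "n = card A"
  have n1: "n \<ge> 1" using finA ne by (simp add: n_def Suc_le_eq card_gt_0_iff)
  \<comment> \<open>The power \<open>1/2000\<close> costs \<open>387 / (641 * 2000)\<close> in the
    exponent, less than \<open>2/3205 - 1/3440\<close>. The factor
    \<open>4001 = 1 + 2 * 2000\<close> covers \<open>1 + ln k\<close> for all
    \<open>k \<le> n ^ 2\<close>, hence both harmonic numbers in use.\<close>
  define L where "L = 768 * 4001 * real n powr (1/2000)"
  have pw: "1 \<le> real n powr (1/2000)" using n1 by (intro ge_one_powr_ge_zero) auto
  have ln_le: "ln (real n) \<le> 2000 * real n powr (1/2000)"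
    using ln_powr_bound[of "real n" "1/2000"] n1 by simp
  have harm_bound: "768 * harm k \<le> L" if "k \<le> n ^ 2" "k > 0" for k
  proof -
    have "harm k \<le> 1 + ln (real k)" using that by (intro harm_le_ln_plus_1)
    also have "\<dots> \<le> 1 + ln (real (n ^ 2))" using that by (intro add_left_mono ln_mono) (auto simp: of_nat_le_iff simp del: of_nat_power)
    also have "\<dots> = 1 + 2 * ln (real n)" using n1 by (simp add: ln_realpow)
    also have "\<dots> \<le> 4001 * real n powr (1/2000)" using ln_le pw by linarith
    finally show ?thesis by (simp add: L_def)
  qed
  have card_le: "card (difs A A) \<le> n ^ 2"
    unfolding difs_def n_def power2_eq_square card_cartesian_product[symmetric]
    using finA by (intro card_image_le) auto
  have "n \<le> n ^ 2" using n1 by (simp add: power2_eq_square)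
  then interpret controlled_set A L
    using harm_bound[of n] n1 by (intro convex_set_controlled cvx ne) (simp add: n_def)
  define m where "m = real (card (difs A A))"
  have m0: "m > 0" using m_pos by (simp add: m_def)
  have "768 * harm (card (difs A A)) \<le> L"
    using harm_bound[OF card_le] m_pos by simp
  moreover have "harm (card (difs A A)) \<ge> (0::real)" by (rule harm_nonneg)
  ultimately have "harm (card (difs A A)) \<le> L" by linarith
  from card_difs_power_bound[OF this]
  have "513 * ln (real n) \<le> 641/2 * ln m + 387/2 * ln L + 795 * ln 2"
    by (simp add: n_def m_def)
  moreover have "ln L = ln (768 * 4001) + 1/2000 * ln (real n)"
    unfolding L_def using n1 by (subst ln_mult_pos) (auto simp: ln_powr)
  moreover have "ln (real n) \<ge> 0" using n1 by simp
  ultimately have "(8/5 + 1/3440) * ln (real n) - (387/641 * ln (768 * 4001) + 1590/641 * ln 2) \<le> ln m"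
    by argo
  then have "exp (- K + (8/5 + 1/3440) * ln (real n)) \<le> exp (ln m)"
    by (simp add: K_def)
  then have "exp (- K) * exp ((8/5 + 1/3440) * ln (real n)) \<le> m"
    using m0 by (simp only: exp_add exp_ln)
  moreover have "real n powr (8/5 + 1/3440) = exp ((8/5 + 1/3440) * ln (real n))"
    using n1 by (simp add: powr_def)
  ultimately show ?thesis
    by (simp only: diff_set_eq_difs m_def n_def K_def)
qed

theorem theorem1p5:
  fixes \<epsilon> :: real
  assumes "\<epsilon> > 0"
  shows "\<exists>c>0. \<forall>A. finite A \<and> convex_set A \<longrightarrow>
           real (card (diff_set A)) \<ge> c * real (card A) powr (8/5 + 1/3440 - \<epsilon>)"
proof -
  define c :: real where "c = exp (- (387/641 * ln (768 * 4001) + 1590/641 * ln 2))"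
  have "c * real (card A) powr (8/5 + 1/3440 - \<epsilon>) \<le> real (card (diff_set A))"
    if A: "finite A" "convex_set A" for A
  \<comment> \<open>For empty \<open>A\<close> the convention \<open>0 powr x = 0\<close> makes the
    bound trivial.\<close>
  proof (cases "A = {}")
    case False
    then have "1 \<le> card A" using A by (simp add: Suc_le_eq card_gt_0_iff)
    then have "c * real (card A) powr (8/5 + 1/3440 - \<epsilon>) \<le> c * real (card A) powr (8/5 + 1/3440)"
      using assms by (intro mult_left_mono powr_mono) (auto simp: c_def)
    also have "\<dots> \<le> real (card (diff_set A))"
      unfolding c_def by (rule card_diff_set_lower[OF A(2) False])
    finally show ?thesis .
  qed simp
  moreover have "c > 0" by (simp add: c_def)
  ultimately show ?thesis by blast
qed

end
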